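(* Let $A$ be a uniform algebra on a compact Hausdorff space $\Omega$, let $E\subset\Omega$ be closed, and suppose that $f\in\mathcal{R}_E(\Omega)$. Then: (i) $f|_{\partial A}\in\mathcal{R}_{E\cap\partial A}(\partial A)$. (ii) If $g=\log f$ (with $\log 0=-\infty$), then $g$ achieves its maximum and minimum on $\partial A$. (iii) If there is a domain $R\subset\mathbb{C}^n$ and an inclusion $R\subset\Omega$ such that all functions in $A$ are analytic functions on $R$, then $g=\log f$ is harmonic (in the usual sense on $R$) wherever it is finite, that is, on $R\setminus E$.
   Context: A uniform algebra on a compact Hausdorff space $\Omega$ is a closed subalgebra of $C(\Omega)$ (complex continuous functions) which contains the constants and separates points. $\partial A\subset\Omega$ is its Shilov boundary; $A$ is also regarded as a uniform algebra on $\partial A$ by restriction. An $A$-tuple is an element of $A^{(n)}$ for some $n$, regarded as a function into $\mathbb{C}^n$; $H\cdot K=\sum_ih_ik_i$ for $A$-tuples of equal length, and $\|\cdot\|_2$ is the Euclidean norm. For a compact space $\Omega$ on which $A$ is a uniform algebra and a closed subset $E\subset\Omega$, $\mathcal{R}_E(\Omega)$ is the set of $f\in C(\Omega)$ which vanish exactly on $E$ and for which there are two sequences $H_n,K_n$ of $A$-tuples ($H_n$, $K_n$ of the same length) such that (a) $\|K_n(w)\|_2\le f(w)\le\|H_n(w)\|_2^{-1}$ for all $w\in\Omega$ (with $\frac10=\infty$), and (b) $H_n(w)\cdot K_n(w)\to1$ uniformly on compact subsets of $\Omega\setminus E$. *)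

theory Defs
  imports "HOL-Analysis.Analysis"
begin

text \<open>
  Functions on the space \<open>X\<close> are total HOL functions that are \<^const>\<open>extensional\<close> on
  \<^term>\<open>topspace X\<close>, so that equality is equality of functions on the space and
  restriction to a subspace \<open>S\<close> is \<open>restrict f S\<close>.
\<close>

definition cont_funs :: "'a topology \<Rightarrow> ('a \<Rightarrow> 'b::topological_space) set" where
  "cont_funs X = {f \<in> extensional (topspace X). continuous_map X euclidean f}"

text \<open>
  Closedness is sequential closedness for the supremum metric; closure under scalar
  multiplication follows from the constants and products.
\<close>

definition uniform_algebra :: "'a topology \<Rightarrow> ('a \<Rightarrow> complex) set \<Rightarrow> bool" where
  "uniform_algebra X A \<longleftrightarrow>
     A \<subseteq> cont_funs X \<and>
     (\<forall>c. (\<lambda>w\<in>topspace X. c) \<in> A) \<and>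
     (\<forall>a\<in>A. \<forall>b\<in>A. (\<lambda>w\<in>topspace X. a w + b w) \<in> A) \<and>
     (\<forall>a\<in>A. \<forall>b\<in>A. (\<lambda>w\<in>topspace X. a w * b w) \<in> A) \<and>
     (\<forall>F a. (\<forall>n. F n \<in> A) \<and> a \<in> cont_funs X \<and>
        uniform_limit (topspace X) F a sequentially \<longrightarrow> a \<in> A) \<and>
     (\<forall>x\<in>topspace X. \<forall>y\<in>topspace X. x \<noteq> y \<longrightarrow> (\<exists>a\<in>A. a x \<noteq> a y))"

definition closed_boundary :: "'a topology \<Rightarrow> ('a \<Rightarrow> complex) set \<Rightarrow> 'a set \<Rightarrow> bool" where
  "closed_boundary X A B \<longleftrightarrow>
     closedin X B \<and> (\<forall>a\<in>A. \<exists>x\<in>B. \<forall>y\<in>topspace X. cmod (a y) \<le> cmod (a x))"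

text \<open>
  For a uniform algebra on a nonempty compact Hausdorff space the intersection is itself a
  closed boundary (Shilov), hence the smallest one.
\<close>

definition shilov_boundary :: "'a topology \<Rightarrow> ('a \<Rightarrow> complex) set \<Rightarrow> 'a set" where
  "shilov_boundary X A = \<Inter> {B. closed_boundary X A B}"

definition restrict_algebra :: "('a \<Rightarrow> 'b) set \<Rightarrow> 'a set \<Rightarrow> ('a \<Rightarrow> 'b) set" where
  "restrict_algebra A S = (\<lambda>a. restrict a S) ` A"

text \<open>An \<open>A\<close>-tuple is a list of elements of \<open>A\<close>.\<close>

definition tuple_norm :: "('a \<Rightarrow> complex) list \<Rightarrow> 'a \<Rightarrow> real" where
  "tuple_norm H w = sqrt (\<Sum>i<length H. (cmod ((H ! i) w))\<^sup>2)"

text \<open>The pairing is bilinear: there is no complex conjugation.\<close>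

definition tuple_dot :: "('a \<Rightarrow> complex) list \<Rightarrow> ('a \<Rightarrow> complex) list \<Rightarrow> 'a \<Rightarrow> complex" where
  "tuple_dot H K w = (\<Sum>i<length H. (H ! i) w * (K ! i) w)"

text \<open>
  The upper bound on \<open>f\<close> is stated in \<^typ>\<open>ereal\<close>, where \<open>1 / 0 = \<infinity>\<close>. The two-sided bound
  only makes sense for real values, so \<open>f\<close> is taken real-valued.
\<close>

definition R_class :: "'a topology \<Rightarrow> ('a \<Rightarrow> complex) set \<Rightarrow> 'a set \<Rightarrow> ('a \<Rightarrow> real) set" where
  "R_class X A E =
     {f \<in> cont_funs X.
        (\<forall>w\<in>topspace X. f w = 0 \<longleftrightarrow> w \<in> E) \<and>
        (\<exists>H K :: nat \<Rightarrow> ('a \<Rightarrow> complex) list.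
           (\<forall>n. set (H n) \<subseteq> A \<and> set (K n) \<subseteq> A \<and> length (H n) = length (K n)) \<and>
           (\<forall>n. \<forall>w\<in>topspace X. tuple_norm (K n) w \<le> f w \<and>
              ereal (f w) \<le> 1 / ereal (tuple_norm (H n) w)) \<and>
           (\<forall>C. compactin X C \<and> C \<subseteq> topspace X - E \<longrightarrow>
              uniform_limit C (\<lambda>n. tuple_dot (H n) (K n)) (\<lambda>_. 1) sequentially))}"

definition log_ereal :: "real \<Rightarrow> ereal" where
  "log_ereal t = (if t = 0 then - \<infinity> else ereal (ln t))"

text \<open>Analyticity in several variables: complex-linear Frechet derivative at every point.\<close>

definition analytic_several_on :: "(complex ^ 'n \<Rightarrow> complex) \<Rightarrow> (complex ^ 'n) set \<Rightarrow> bool" where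
  "analytic_several_on F R \<longleftrightarrow> open R \<and>
     (\<forall>z\<in>R. \<exists>F'. (F has_derivative F') (at z) \<and> (\<forall>c v. F' (c *s v) = c * F' v))"

text \<open>
  Twice continuously differentiable with zero Laplacian (the trace of the second derivative
  \<open>u''\<close>). On \<^typ>\<open>complex ^ 'n\<close>, \<^const>\<open>Basis\<close> is the standard real orthonormal basis, so
  this is harmonicity in \<open>2n\<close> real variables.
\<close>

definition harmonic_on :: "('v::euclidean_space \<Rightarrow> real) \<Rightarrow> 'v set \<Rightarrow> bool" where
  "harmonic_on u U \<longleftrightarrow> open U \<and>
     (\<exists>(u' :: 'v \<Rightarrow> 'v \<Rightarrow>\<^sub>L real) (u'' :: 'v \<Rightarrow> 'v \<Rightarrow>\<^sub>L 'v \<Rightarrow>\<^sub>L real).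
        (\<forall>x\<in>U. (u has_derivative blinfun_apply (u' x)) (at x)) \<and>
        (\<forall>x\<in>U. (u' has_derivative blinfun_apply (u'' x)) (at x)) \<and>
        continuous_on U u'' \<and>
        (\<forall>x\<in>U. (\<Sum>b\<in>Basis. blinfun_apply (blinfun_apply (u'' x) b) b) = 0))"

end

theory Submission
  imports Defs "HOL-Complex_Analysis.Complex_Analysis"
begin

text \<open>
  Freeze one tuple at a point \<open>v\<close> outside \<open>E\<close>: by Cauchy--Schwarz the functions
  \<open>a n = H n v \<cdot> K n\<close> and \<open>b n = H n \<cdot> K n v\<close> lie in \<open>A\<close>, satisfy \<open>|a n| \<le> f / f v\<close> and
  \<open>|b n| \<le> f v / f\<close>, and tend to \<open>1\<close> at \<open>v\<close>. Since they attain their maximum modulus on the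
  Shilov boundary, so do \<open>f\<close> and \<open>1 / f\<close>; if \<open>E\<close> misses the boundary, then \<open>H n \<cdot> K n\<close> tends
  to \<open>1\<close> uniformly on the boundary, hence on the whole space, and \<open>E\<close> is empty. On an analytic
  piece, \<open>|a n * b m| \<le> 1\<close> and Harnack's inequality make \<open>a n\<close> converge near \<open>v\<close> to an analytic
  \<open>F\<close> with \<open>|F| = f / f v\<close>, so \<open>ln f\<close> is locally the real part of an analytic function.
\<close>

subsection \<open>The Shilov boundary\<close>

text \<open>\<open>shilov_boundary\<close> is merely an intersection, so that maxima are attained on
  it is a theorem (Shilov's); the extremal statements about \<open>f\<close> are then proved for an
  arbitrary closed boundary. The obstacle is that neither \<open>f\<close> nor its logarithm belongs
  to \<open>A\<close>, so no maximum principle applies to them directly. Evaluating one tuple at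
  \<open>v\<close> turns the pairing into elements of \<open>A\<close>: \<open>a n\<close> is
  controlled by \<open>f\<close> and yields the maximum, \<open>b n\<close> by \<open>1 / f\<close>
  and yields the minimum. On an analytic piece the \<open>a n\<close> are known to converge only at
  \<open>v\<close>. The indices of \<open>a n\<close> and \<open>b m\<close> are independent because
  \<open>f\<close> cancels in the product for every pair; comparing \<open>a n * b n\<close> with
  \<open>a m * b n\<close> then bounds \<open>a n - a m\<close>, since \<open>b n\<close> stays away
  from 0. So the whole sequence converges, without extracting subsequences.
  \<open>harmonic_on\<close> asks for continuous second derivatives, whereas analyticity is bare
  complex differentiability; Cauchy estimates on complex lines close this gap by showing that
  directional derivatives are again analytic.\<close>

lemma compactin_attains_sup:
  fixes h :: "'a \<Rightarrow> real"
  assumes "compactin X S" "S \<noteq> {}" "continuous_map X euclidean h"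
  shows "\<exists>x\<in>S. \<forall>y\<in>S. h y \<le> h x"
proof -
  have "compact (h ` S)"
    using image_compactin[OF assms(1,3)] by simp
  then show ?thesis
    using compact_attains_sup[of "h ` S"] assms(2) by blast
qed

context
  fixes X :: "'a topology" and A :: "('a \<Rightarrow> complex) set"
  assumes uniform_algebra: "uniform_algebra X A"
begin

lemma
  algebra_subset: "A \<subseteq> cont_funs X"
  and algebra_const: "(\<lambda>w\<in>topspace X. c) \<in> A"
  and algebra_add: "a \<in> A \<Longrightarrow> b \<in> A \<Longrightarrow> (\<lambda>w\<in>topspace X. a w + b w) \<in> A"
  and algebra_mult: "a \<in> A \<Longrightarrow> b \<in> A \<Longrightarrow> (\<lambda>w\<in>topspace X. a w * b w) \<in> A"
  and algebra_separates:
    "x \<in> topspace X \<Longrightarrow> y \<in> topspace X \<Longrightarrow> x \<noteq> y \<Longrightarrow> \<exists>a\<in>A. a x \<noteq> a y"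
  using uniform_algebra by (simp_all add: uniform_algebra_def)

lemma algebra_continuous: "a \<in> A \<Longrightarrow> continuous_map X euclidean a"
  using algebra_subset unfolding cont_funs_def by blast

lemma algebra_continuous_norm: "a \<in> A \<Longrightarrow> continuous_map X euclidean (\<lambda>x. cmod (a x))"
  by (intro continuous_map_norm algebra_continuous)

text \<open>The closure rules produce nested \<open>restrict\<close> terms. Elements of
  \<open>A\<close> are extensional, so agreement on the space is enough to replace such a term by
  its simplified form.\<close>

lemma algebra_cong:
  assumes "a \<in> A" "\<And>w. w \<in> topspace X \<Longrightarrow> a w = b w"
  shows "restrict b (topspace X) \<in> A"
proof -
  have "a \<in> extensional (topspace X)"
    using assms(1) algebra_subset unfolding cont_funs_def by blast
  then have "a = restrict b (topspace X)"
    using assms(2) by (intro extensionalityI[of _ "topspace X"]) auto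
  then show ?thesis using assms(1) by simp
qed

lemma algebra_cmult: "a \<in> A \<Longrightarrow> (\<lambda>w\<in>topspace X. c * a w) \<in> A"
  by (rule algebra_cong[OF algebra_mult[OF algebra_const[of c]]]) auto

lemma algebra_affine: "a \<in> A \<Longrightarrow> (\<lambda>w\<in>topspace X. c * a w + d) \<in> A"
  by (rule algebra_cong[OF algebra_add[OF algebra_cmult[of a c] algebra_const[of d]]]) auto

lemma algebra_sum:
  assumes "finite I" "\<And>i. i \<in> I \<Longrightarrow> g i \<in> A"
  shows "(\<lambda>w\<in>topspace X. \<Sum>i\<in>I. g i w) \<in> A"
  using assms
proof (induction I rule: finite_induct)
  case empty
  show ?case using algebra_const[of 0] by (simp only: sum.empty)
next
  case (insert i I)
  then have "(\<lambda>w\<in>topspace X. \<Sum>i\<in>I. g i w) \<in> A" "g i \<in> A" by blast+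
  then show ?case
    by (rule algebra_cong[OF algebra_add[rotated]]) (use insert(1,2) in simp)
qed

lemma algebra_power: "a \<in> A \<Longrightarrow> (\<lambda>w\<in>topspace X. a w ^ n) \<in> A"
proof (induction n)
  case 0
  show ?case using algebra_const[of 1] by (simp only: power_0)
next
  case (Suc n)
  then have "(\<lambda>w\<in>topspace X. a w ^ n) \<in> A" by blast
  then show ?case
    by (rule algebra_cong[OF algebra_mult[OF Suc(2)]]) simp
qed

lemma algebra_linear_combination:
  assumes "set K \<subseteq> A"
  shows "(\<lambda>w\<in>topspace X. \<Sum>i<length K. c i * (K ! i) w) \<in> A"
proof -
  have "(\<lambda>w\<in>topspace X. c i * (K ! i) w) \<in> A" if "i < length K" for i
    using that assms by (intro algebra_cmult) auto
  then have "(\<lambda>w\<in>topspace X. \<Sum>i<length K. (\<lambda>w\<in>topspace X. c i * (K ! i) w) w) \<in> A"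
    by (intro algebra_sum) blast+
  then show ?thesis
    by (rule algebra_cong) simp
qed

lemma algebra_tuple_dot:
  assumes "set H \<subseteq> A" "set K \<subseteq> A" "length H = length K"
  shows "restrict (tuple_dot H K) (topspace X) \<in> A"
proof -
  have "(\<lambda>w\<in>topspace X. (H ! i) w * (K ! i) w) \<in> A" if "i < length K" for i
    using that assms by (intro algebra_mult) auto
  then have "(\<lambda>w\<in>topspace X. \<Sum>i<length K. (\<lambda>w\<in>topspace X. (H ! i) w * (K ! i) w) w) \<in> A"
    by (intro algebra_sum) blast+
  then show ?thesis
    by (rule algebra_cong) (simp add: tuple_dot_def assms(3))
qed

section \<open>Basic neighbourhoods cut out by finitely many elements of \<open>A\<close>\<close>

definition polynomial_nhd :: "('a \<Rightarrow> complex) set \<Rightarrow> 'a set" where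
  "polynomial_nhd G = {x \<in> topspace X. \<forall>g\<in>G. cmod (g x) < 1}"

lemma openin_polynomial_nhd:
  assumes "finite G" "G \<subseteq> A"
  shows "openin X (polynomial_nhd G)"
proof -
  have "openin X {x \<in> topspace X. cmod (g x) \<in> {..<1}}" if "g \<in> G" for g
    using that assms by (intro openin_continuous_map_preimage[OF algebra_continuous_norm]) auto
  then have "openin X (topspace X \<inter> \<Inter>((\<lambda>g. {x \<in> topspace X. cmod (g x) < 1}) ` G))"
    using assms(1) by (intro openin_Int_Inter) auto
  also have "topspace X \<inter> \<Inter>((\<lambda>g. {x \<in> topspace X. cmod (g x) < 1}) ` G) = polynomial_nhd G"
    unfolding polynomial_nhd_def by auto
  finally show ?thesis .
qed

text \<open>An affine change of a separating function gives the values 2 and 0. The threshold 1 then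
  lies strictly between them, so \<open>{cmod g > 1}\<close> is an open set around \<open>x\<close>
  disjoint from the basic neighbourhood \<open>{cmod g < 1}\<close> of \<open>y\<close>.\<close>

lemma algebra_separates_strongly:
  assumes "x \<in> topspace X" "y \<in> topspace X" "x \<noteq> y"
  obtains g where "g \<in> A" "g y = 0" "cmod (g x) > 1"
proof -
  obtain a where a: "a \<in> A" "a x \<noteq> a y"
    using algebra_separates assms by blast
  define g where "g = (\<lambda>w\<in>topspace X. 2 / (a x - a y) * a w + - (2 / (a x - a y) * a y))"
  have "g z = 2 * ((a z - a y) / (a x - a y))" if "z \<in> topspace X" for z
    using that unfolding g_def by (simp add: right_diff_distrib diff_divide_distrib)
  then have "g x = 2" "g y = 0"
    using a(2) assms by (simp_all add: divide_eq_eq right_diff_distrib)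
  moreover have "g \<in> A"
    unfolding g_def by (rule algebra_affine[OF a(1)])
  ultimately show ?thesis
    using that[of g] by simp
qed

text \<open>On a compact space, separation of points makes the topology the weak topology of
  \<open>A\<close>. The complement of \<open>V\<close> is compact and covered by sets
  \<open>{cmod g > 1}\<close> with \<open>g y = 0\<close>; the functions of a finite subcover define
  the neighbourhood.\<close>

lemma polynomial_nhd_base:
  assumes "compact_space X" "openin X V" "y \<in> V"
  obtains G where "finite G" "G \<subseteq> A" "y \<in> polynomial_nhd G" "polynomial_nhd G \<subseteq> V"
proof -
  have y: "y \<in> topspace X"
    using assms openin_subset by blast
  define \<U> where "\<U> = {{x \<in> topspace X. cmod (g x) > 1} | g. g \<in> A \<and> g y = 0}"
  have "compactin X (topspace X - V)"
    using assms(1,2) closedin_compact_space by blast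
  moreover have "openin X U" if "U \<in> \<U>" for U
  proof -
    obtain g where g: "g \<in> A" "U = {x \<in> topspace X. cmod (g x) \<in> {1<..}}"
      using \<open>U \<in> \<U>\<close> unfolding \<U>_def by auto
    show ?thesis
      unfolding g(2) by (intro openin_continuous_map_preimage[OF algebra_continuous_norm[OF g(1)]]) auto
  qed
  moreover have "topspace X - V \<subseteq> \<Union>\<U>"
  proof
    fix x assume x: "x \<in> topspace X - V"
    then have "x \<noteq> y" using assms(3) by blast
    then obtain g where "g \<in> A" "g y = 0" "cmod (g x) > 1"
      using algebra_separates_strongly[of x y] x y by blast
    then show "x \<in> \<Union>\<U>"
      using x unfolding \<U>_def by blast
  qed
  ultimately obtain \<F> where \<F>: "finite \<F>" "\<F> \<subseteq> \<U>" "topspace X - V \<subseteq> \<Union>\<F>"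
    unfolding compactin_def by meson
  have "\<forall>U\<in>\<F>. \<exists>g. g \<in> A \<and> g y = 0 \<and> U = {x \<in> topspace X. cmod (g x) > 1}"
    using \<F>(2) unfolding \<U>_def by blast
  then obtain \<gamma> where \<gamma>: "\<And>U. U \<in> \<F> \<Longrightarrow> \<gamma> U \<in> A \<and> \<gamma> U y = 0 \<and> U = {x \<in> topspace X. cmod (\<gamma> U x) > 1}"
    by metis
  show ?thesis
  proof (rule that[of "\<gamma> ` \<F>"])
    show "polynomial_nhd (\<gamma> ` \<F>) \<subseteq> V"
    proof
      fix x assume x: "x \<in> polynomial_nhd (\<gamma> ` \<F>)"
      show "x \<in> V"
      proof (rule ccontr)
        assume "x \<notin> V"
        then obtain U where "U \<in> \<F>" "x \<in> U"
          using x \<F>(3) unfolding polynomial_nhd_def by blast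
        then show False
          using \<gamma>[OF \<open>U \<in> \<F>\<close>] x unfolding polynomial_nhd_def by (metis (no_types, lifting) image_eqI mem_Collect_eq not_less_iff_gr_or_eq)
      qed
    qed
  qed (use \<gamma> \<F> y in \<open>auto simp: polynomial_nhd_def\<close>)
qed

text \<open>
  If removing the neighbourhood from \<open>B\<close> destroyed a maximum, a high power of the
  offending function would have all its maxima inside the neighbourhood, so every closed boundary
  would meet it.
\<close>

lemma closed_boundary_Diff_polynomial_nhd:
  assumes comp: "compact_space X"
    and G: "finite G" "G \<subseteq> A"
    and B0: "closed_boundary X A B0" "polynomial_nhd G \<inter> B0 = {}"
    and B: "closed_boundary X A B"
  shows "closed_boundary X A (B - polynomial_nhd G)"
proof (rule ccontr)
  define U where "U = polynomial_nhd G"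
  have clBU: "closedin X (B - U)"
    using B openin_polynomial_nhd[OF G] unfolding closed_boundary_def U_def
    by (simp add: closedin_diff)
  then have compBU: "compactin X (B - U)"
    using comp closedin_compact_space by blast
  have BX: "B \<subseteq> topspace X" "B0 \<subseteq> topspace X"
    using B B0 closedin_subset unfolding closed_boundary_def by blast+
  assume "\<not> closed_boundary X A (B - polynomial_nhd G)"
  then obtain a' where a': "a' \<in> A" "\<not> (\<exists>x\<in>B - U. \<forall>y\<in>topspace X. cmod (a' y) \<le> cmod (a' x))"
    using clBU unfolding closed_boundary_def U_def by blast
  \<comment> \<open>A function that is not identically 0 is needed, since it will be divided by its
    maximum modulus. If \<open>a'\<close> vanishes everywhere, its failure to attain a maximum
    forces \<open>B - U\<close> to be empty, and the constant 1 then serves instead.\<close>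
  have "\<exists>a\<in>A. (\<forall>x\<in>B - U. \<exists>y\<in>topspace X. cmod (a x) < cmod (a y)) \<and> (\<exists>x\<in>topspace X. a x \<noteq> 0)"
  proof (cases "\<exists>x\<in>topspace X. a' x \<noteq> 0")
    case True
    then show ?thesis using a' by (metis linorder_not_less)
  next
    case False
    then have "B - U = {}"
      using a' BX by force
    moreover obtain x where "x \<in> topspace X"
      using B a'(1) BX unfolding closed_boundary_def by blast
    ultimately show ?thesis
      by (intro bexI[OF _ algebra_const[of 1]]) auto
  qed
  then obtain a x0 where a: "a \<in> A" "\<And>x. x \<in> B - U \<Longrightarrow> \<exists>y\<in>topspace X. cmod (a x) < cmod (a y)"
      "x0 \<in> topspace X" "a x0 \<noteq> 0"
    by blast
  \<comment> \<open>The maximum point is taken in \<open>B0\<close>, which misses \<open>U\<close>;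
    the contradiction will be that \<open>y0\<close> lies in \<open>U\<close>.\<close>
  obtain y0 where y0: "y0 \<in> B0" "\<And>y. y \<in> topspace X \<Longrightarrow> cmod (a y) \<le> cmod (a y0)"
    using B0(1) a(1) unfolding closed_boundary_def by blast
  define M where "M = cmod (a y0)"
  have M: "M > 0"
    using y0(2)[OF a(3)] a(4) unfolding M_def by (meson less_le_trans zero_less_norm_iff)
  have less_M: "cmod (a x) < M" if "x \<in> B - U" for x
    using a(2)[OF that] y0(2) unfolding M_def by (meson less_le_trans)
  \<comment> \<open>Compactness of \<open>B - U\<close> upgrades the pointwise strict inequality to
    a uniform gap, so that powers of \<open>a / M\<close> become uniformly small there.\<close>
  obtain r where r: "0 \<le> r" "r < 1" "\<And>x. x \<in> B - U \<Longrightarrow> cmod (a x) / M \<le> r"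
  proof (cases "B - U = {}")
    case True
    then show ?thesis
      by (intro that[of 0]) auto
  next
    case False
    obtain x1 where "x1 \<in> B - U" "\<And>x. x \<in> B - U \<Longrightarrow> cmod (a x) \<le> cmod (a x1)"
      using compactin_attains_sup[OF compBU False algebra_continuous_norm[OF a(1)]] by blast
    then show ?thesis
      using that[of "cmod (a x1) / M"] less_M M by (simp add: divide_simps)
  qed
  have "\<exists>C. \<forall>x\<in>topspace X. cmod (g x) \<le> C" if "g \<in> G" for g
    using compactin_attains_sup[of X "topspace X", OF _ _ algebra_continuous_norm, of g] that G(2) comp a(3)
    unfolding compact_space_def by blast
  then obtain C where C: "\<And>g x. g \<in> G \<Longrightarrow> x \<in> topspace X \<Longrightarrow> cmod (g x) \<le> C g"
    by metis
  \<comment> \<open>A common bound for all of \<open>G\<close>, so that a single exponent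
    \<open>N\<close> works for every \<open>g\<close>. The inserted 1 keeps \<open>D\<close>
    positive, also when \<open>G\<close> is empty.\<close>
  define D where "D = Max (insert 1 (C ` G))"
  have D: "D \<ge> 1" "\<And>g. g \<in> G \<Longrightarrow> C g \<le> D"
    unfolding D_def using G(1) by auto
  have "(\<lambda>n. r ^ n) \<longlonglongrightarrow> 0"
    using r by (intro LIMSEQ_power_zero) auto
  then have "eventually (\<lambda>n. r ^ n < 1 / D) sequentially"
    using D(1) by (intro order_tendstoD(2)) auto
  then obtain N where "r ^ N < 1 / D"
    unfolding eventually_sequentially by blast
  then have N: "r ^ N * D < 1"
    using D(1) by (simp add: field_simps)
  have "y0 \<in> U"
    unfolding U_def polynomial_nhd_def
  proof (intro CollectI conjI ballI)
    show "y0 \<in> topspace X"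
      using y0(1) BX by blast
    fix g assume g: "g \<in> G"
    \<comment> \<open>The test function is \<open>(a / M) ^ N * g\<close>. On \<open>B\<close> it is
      below 1 in modulus: inside \<open>U\<close> because \<open>g\<close> is, outside because
      \<open>r ^ N * D < 1\<close>. As \<open>B\<close> is a boundary the bound holds at
      \<open>y0\<close>, where \<open>a / M\<close> has modulus 1, leaving
      \<open>cmod (g y0) < 1\<close>.\<close>
    define p where "p = (\<lambda>w\<in>topspace X. (\<lambda>w\<in>topspace X. (\<lambda>w\<in>topspace X. of_real (1 / M) * a w) w ^ N) w * g w)"
    have "p \<in> A"
      unfolding p_def using algebra_mult[OF algebra_power[OF algebra_cmult[OF a(1)]]] g G(2) by blast
    then obtain x2 where x2: "x2 \<in> B" "\<And>y. y \<in> topspace X \<Longrightarrow> cmod (p y) \<le> cmod (p x2)"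
      using B unfolding closed_boundary_def by blast
    have p: "cmod (p x) = (cmod (a x) / M) ^ N * cmod (g x)" if "x \<in> topspace X" for x
      using that M unfolding p_def by (simp add: norm_mult norm_power norm_divide power_divide)
    have "cmod (p x2) < 1"
    proof (cases "x2 \<in> U")
      case True
      have "cmod (a x2) / M \<le> 1"
        using y0(2)[of x2] x2(1) BX M unfolding M_def by auto
      then have "(cmod (a x2) / M) ^ N \<le> 1"
        using M by (intro power_le_one) auto
      then have "(cmod (a x2) / M) ^ N * cmod (g x2) \<le> 1 * cmod (g x2)"
        by (intro mult_right_mono) auto
      also have "\<dots> < 1"
        using True g unfolding U_def polynomial_nhd_def by auto
      finally show ?thesis
        using p x2(1) BX by auto
    next
      case False
      have "(cmod (a x2) / M) ^ N * cmod (g x2) \<le> r ^ N * D"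
        using r(3)[of x2] False x2(1) C[OF g, of x2] D(2)[OF g] BX M r(1)
        by (intro mult_mono power_mono) auto
      then show ?thesis
        using N p x2(1) BX by auto
    qed
    then have "cmod (p y0) < 1"
      using x2(2)[OF \<open>y0 \<in> topspace X\<close>] by linarith
    then show "cmod (g y0) < 1"
      using p[OF \<open>y0 \<in> topspace X\<close>] M unfolding M_def by simp
  qed
  then show False
    using y0(1) B0(2) unfolding U_def by blast
qed

text \<open>If the set \<open>L\<close> where \<open>a\<close> has maximal modulus missed the
  intersection, each of its points would have a basic neighbourhood disjoint from some closed
  boundary. Finitely many of these cover \<open>L\<close>, and deleting them from the space leaves a
  closed boundary on which \<open>a\<close> misses its maximum.\<close>

theorem closed_boundary_shilov_boundary:
  assumes comp: "compact_space X" and ne: "topspace X \<noteq> {}"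
  shows "closed_boundary X A (shilov_boundary X A)"
proof -
  have comp': "compactin X (topspace X)"
    using comp unfolding compact_space_def .
  have top: "closed_boundary X A (topspace X)"
    using compactin_attains_sup[OF comp' ne algebra_continuous_norm] unfolding closed_boundary_def by blast
  have clos: "closedin X (shilov_boundary X A)"
    unfolding shilov_boundary_def using top
    by (intro closedin_Inter) (auto simp: closed_boundary_def)
  have "\<exists>x\<in>shilov_boundary X A. \<forall>y\<in>topspace X. cmod (a y) \<le> cmod (a x)" if a: "a \<in> A" for a
  proof (rule ccontr)
    assume no: "\<not> ?thesis"
    obtain x0 where x0: "x0 \<in> topspace X" "\<And>y. y \<in> topspace X \<Longrightarrow> cmod (a y) \<le> cmod (a x0)"
      using top a unfolding closed_boundary_def by blast
    define L where "L = {y \<in> topspace X. cmod (a y) \<in> {cmod (a x0)..}}"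
    have "closedin X L"
      unfolding L_def by (intro closedin_continuous_map_preimage[OF algebra_continuous_norm[OF a]]) auto
    then have "compactin X L"
      using comp closedin_compact_space by blast
    define \<U> where "\<U> = {polynomial_nhd G | G. finite G \<and> G \<subseteq> A \<and>
      (\<exists>B. closed_boundary X A B \<and> polynomial_nhd G \<inter> B = {})}"
    have "openin X U" if "U \<in> \<U>" for U
      using that openin_polynomial_nhd unfolding \<U>_def by blast
    moreover have "L \<subseteq> \<Union>\<U>"
    proof
      fix y assume y: "y \<in> L"
      then have "y \<notin> shilov_boundary X A"
        using no x0(2) unfolding L_def by fastforce
      then obtain B where B: "closed_boundary X A B" "y \<notin> B"
        unfolding shilov_boundary_def by blast
      have "openin X (topspace X - B)" "y \<in> topspace X - B"
        using B y unfolding closed_boundary_def L_def by auto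
      then obtain G where "finite G" "G \<subseteq> A" "y \<in> polynomial_nhd G" "polynomial_nhd G \<subseteq> topspace X - B"
        using polynomial_nhd_base[OF comp] by metis
      then show "y \<in> \<Union>\<U>"
        using B(1) unfolding \<U>_def by blast
    qed
    ultimately obtain \<F> where \<F>: "finite \<F>" "\<F> \<subseteq> \<U>" "L \<subseteq> \<Union>\<F>"
      using \<open>compactin X L\<close> unfolding compactin_def by meson
    \<comment> \<open>The neighbourhoods are deleted one at a time, starting from the whole space.
      Each may be disjoint from a different closed boundary \<open>B\<close>, which is why the
      deletion lemma keeps \<open>B0\<close> and \<open>B\<close> apart.\<close>
    have "closed_boundary X A (topspace X - \<Union>\<F>)"
      using \<F>(1,2)
    proof (induction \<F> rule: finite_induct)
      case empty
      then show ?case using top by simp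
    next
      case (insert U \<F>)
      obtain G B where "finite G" "G \<subseteq> A" "closed_boundary X A B" "polynomial_nhd G \<inter> B = {}"
          "U = polynomial_nhd G"
        using insert.prems unfolding \<U>_def by auto
      then have "closed_boundary X A ((topspace X - \<Union>\<F>) - U)"
        using closed_boundary_Diff_polynomial_nhd[OF comp, of G B] insert by auto
      moreover have "(topspace X - \<Union>\<F>) - U = topspace X - \<Union>(insert U \<F>)"
        by blast
      ultimately show ?case by simp
    qed
    then obtain x where "x \<in> topspace X - \<Union>\<F>" "\<forall>y\<in>topspace X. cmod (a y) \<le> cmod (a x)"
      using a unfolding closed_boundary_def by blast
    then have "x \<in> L" "x \<notin> L"
      using x0 \<F>(3) unfolding L_def by auto
    then show False by blast
  qed
  then show ?thesis
    using clos unfolding closed_boundary_def by blast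
qed

end

subsection \<open>The maximum and minimum on a closed boundary\<close>

text \<open>Cauchy--Schwarz with the two tuples evaluated at different points, as needed when one of
  them is frozen.\<close>

lemma norm_tuple_dot_le:
  assumes "length H = length K"
  shows "cmod (\<Sum>i<length K. (H ! i) v * (K ! i) w) \<le> tuple_norm H v * tuple_norm K w"
proof -
  have "cmod (\<Sum>i<length K. (H ! i) v * (K ! i) w) \<le> (\<Sum>i<length K. \<bar>cmod ((H ! i) v)\<bar> * \<bar>cmod ((K ! i) w)\<bar>)"
    by (rule order_trans[OF norm_sum]) (simp add: norm_mult)
  also have "\<dots> \<le> L2_set (\<lambda>i. cmod ((H ! i) v)) {..<length K} * L2_set (\<lambda>i. cmod ((K ! i) w)) {..<length K}"
    by (rule L2_set_mult_ineq)
  finally show ?thesis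
    using assms by (simp add: tuple_norm_def L2_set_def)
qed

lemma tuple_norm_nonneg: "tuple_norm H w \<ge> 0"
  unfolding tuple_norm_def by (simp add: sum_nonneg)

lemma log_ereal_mono: "0 \<le> s \<Longrightarrow> s \<le> t \<Longrightarrow> log_ereal s \<le> log_ereal t"
  unfolding log_ereal_def by auto

section \<open>The class of \<open>f\<close>: unpacking, frozen tuples, restriction\<close>

lemma R_classI:
  fixes H K :: "nat \<Rightarrow> ('a \<Rightarrow> complex) list"
  assumes "f \<in> cont_funs X" "\<And>w. w \<in> topspace X \<Longrightarrow> f w = 0 \<longleftrightarrow> w \<in> E"
    and "\<And>n. set (H n) \<subseteq> A \<and> set (K n) \<subseteq> A \<and> length (H n) = length (K n)"
    and "\<And>n w. w \<in> topspace X \<Longrightarrow> tuple_norm (K n) w \<le> f w \<and> ereal (f w) \<le> 1 / ereal (tuple_norm (H n) w)"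
    and "\<And>C. compactin X C \<and> C \<subseteq> topspace X - E \<Longrightarrow>
       uniform_limit C (\<lambda>n. tuple_dot (H n) (K n)) (\<lambda>_. 1) sequentially"
  shows "f \<in> R_class X A E"
  unfolding R_class_def
  by (rule CollectI, rule conjI, fact, rule conjI, use assms(2) in blast,
      rule exI[of _ H], rule exI[of _ K]) (simp add: assms(3-))

text \<open>The \<open>ereal\<close> bound is converted into a product inequality between reals,
  which remains meaningful where \<open>tuple_norm (H n) w = 0\<close>.\<close>

lemma R_class_pair:
  assumes "f \<in> R_class X A E"
  obtains H K where
    "\<And>n. set (H n) \<subseteq> A" "\<And>n. set (K n) \<subseteq> A" "\<And>n. length (H n) = length (K n)"
    "\<And>n w. w \<in> topspace X \<Longrightarrow> tuple_norm (K n) w \<le> f w"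
    "\<And>n w. w \<in> topspace X \<Longrightarrow> f w * tuple_norm (H n) w \<le> 1"
    "\<And>C. compactin X C \<Longrightarrow> C \<inter> E = {} \<Longrightarrow>
       uniform_limit C (\<lambda>n. tuple_dot (H n) (K n)) (\<lambda>_. 1) sequentially"
proof -
  obtain H K :: "nat \<Rightarrow> ('a \<Rightarrow> complex) list" where HK:
      "\<And>n. set (H n) \<subseteq> A \<and> set (K n) \<subseteq> A \<and> length (H n) = length (K n)"
      "\<And>n w. w \<in> topspace X \<Longrightarrow> tuple_norm (K n) w \<le> f w \<and> ereal (f w) \<le> 1 / ereal (tuple_norm (H n) w)"
      "\<And>C. compactin X C \<and> C \<subseteq> topspace X - E \<Longrightarrow>
       uniform_limit C (\<lambda>n. tuple_dot (H n) (K n)) (\<lambda>_. 1) sequentially"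
    using assms unfolding R_class_def by blast
  have "f w * tuple_norm (H n) w \<le> 1" if w: "w \<in> topspace X" for n w
  proof (cases "tuple_norm (H n) w = 0")
    case False
    then have "tuple_norm (H n) w > 0"
      using tuple_norm_nonneg[of "H n" w] by linarith
    moreover have "f w \<le> 1 / tuple_norm (H n) w"
      using HK(2)[OF w, of n] False by (simp add: one_ereal_def)
    ultimately show ?thesis
      by (simp add: field_simps)
  qed simp
  then show ?thesis
  proof (intro that[of H K])
    show "uniform_limit C (\<lambda>n. tuple_dot (H n) (K n)) (\<lambda>_. 1) sequentially"
      if "compactin X C" "C \<inter> E = {}" for C
      using that compactin_subset_topspace[OF that(1)] by (intro HK(3)) blast
  qed (use HK in auto)
qed

lemma R_class_nonneg:
  assumes "f \<in> R_class X A E" "w \<in> topspace X"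
  shows "0 \<le> f w"
  using R_class_pair[OF assms(1)] tuple_norm_nonneg assms(2) by (metis order_trans)

lemma R_class_zero_iff:
  "f \<in> R_class X A E \<Longrightarrow> w \<in> topspace X \<Longrightarrow> f w = 0 \<longleftrightarrow> w \<in> E"
  unfolding R_class_def by blast

lemma R_class_pos:
  assumes "f \<in> R_class X A E" "w \<in> topspace X" "w \<notin> E"
  shows "f w > 0"
  using R_class_nonneg[OF assms(1,2)] R_class_zero_iff[OF assms(1,2)] assms(3) by simp

lemma R_class_continuous: "f \<in> R_class X A E \<Longrightarrow> continuous_map X euclidean f"
  unfolding R_class_def cont_funs_def by blast

text \<open>The bound on \<open>b n\<close> is kept in product form because \<open>f\<close> may
  vanish at \<open>w\<close>. Convergence is claimed only at \<open>v\<close>, where it is the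
  uniform convergence on the compact set \<open>{v}\<close>.\<close>

lemma R_class_peaking:
  assumes A: "uniform_algebra X A" and f: "f \<in> R_class X A E" and v: "v \<in> topspace X" "v \<notin> E"
  shows "\<exists>a b. (\<forall>n. a n \<in> A) \<and> (\<forall>n. b n \<in> A) \<and>
    (\<forall>n. \<forall>w\<in>topspace X. cmod (a n w) \<le> f w / f v) \<and>
    (\<forall>n. \<forall>w\<in>topspace X. cmod (b n w) * f w \<le> f v) \<and>
    (\<lambda>n. a n v) \<longlonglongrightarrow> 1 \<and> (\<lambda>n. b n v) \<longlonglongrightarrow> 1"
proof -
  obtain H K where HK:
    "\<And>n. set (H n) \<subseteq> A" "\<And>n. set (K n) \<subseteq> A" "\<And>n. length (H n) = length (K n)"
    "\<And>n w. w \<in> topspace X \<Longrightarrow> tuple_norm (K n) w \<le> f w"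
    "\<And>n w. w \<in> topspace X \<Longrightarrow> f w * tuple_norm (H n) w \<le> 1"
    "\<And>C. compactin X C \<Longrightarrow> C \<inter> E = {} \<Longrightarrow>
       uniform_limit C (\<lambda>n. tuple_dot (H n) (K n)) (\<lambda>_. 1) sequentially"
    using R_class_pair[OF f] by blast
  have fv: "f v > 0"
    using R_class_pos[OF f v] .
  have lim: "(\<lambda>n. tuple_dot (H n) (K n) v) \<longlonglongrightarrow> 1"
    using tendsto_uniform_limitI[OF HK(6)[of "{v}"], of v] v by simp
  define a where "a n = (\<lambda>w\<in>topspace X. \<Sum>i<length (K n). (H n ! i) v * (K n ! i) w)" for n
  define b where "b n = (\<lambda>w\<in>topspace X. \<Sum>i<length (H n). (K n ! i) v * (H n ! i) w)" for n
  have "a n \<in> A" for n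
    unfolding a_def by (rule algebra_linear_combination[OF A HK(2)])
  moreover have "b n \<in> A" for n
    unfolding b_def by (rule algebra_linear_combination[OF A HK(1)])
  moreover have "cmod (a n w) \<le> f w / f v" if w: "w \<in> topspace X" for n w
  proof -
    have "cmod (a n w) \<le> tuple_norm (H n) v * tuple_norm (K n) w"
      using norm_tuple_dot_le[OF HK(3), of n v w] w unfolding a_def by simp
    also have "\<dots> \<le> 1 / f v * f w"
      using HK(4)[OF w, of n] HK(5)[OF v(1), of n] fv tuple_norm_nonneg
      by (intro mult_mono) (auto simp: field_simps)
    finally show ?thesis by simp
  qed
  moreover have "cmod (b n w) * f w \<le> f v" if w: "w \<in> topspace X" for n w
  proof -
    have "cmod (b n w) * f w \<le> (tuple_norm (K n) v * tuple_norm (H n) w) * f w"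
      using norm_tuple_dot_le[of "K n" "H n" v w] HK(3)[of n] R_class_nonneg[OF f w] w
      unfolding b_def by (intro mult_right_mono) auto
    also have "\<dots> = tuple_norm (K n) v * (f w * tuple_norm (H n) w)"
      by simp
    also have "\<dots> \<le> f v * 1"
      using HK(4)[OF v(1), of n] HK(5)[OF w, of n] R_class_nonneg[OF f w] fv
      by (intro mult_mono) (auto simp: tuple_norm_nonneg)
    finally show ?thesis by simp
  qed
  moreover have "(\<lambda>n. a n v) \<longlonglongrightarrow> 1" "(\<lambda>n. b n v) \<longlonglongrightarrow> 1"
    using lim v(1) HK(3) by (simp_all add: a_def b_def tuple_dot_def mult.commute)
  ultimately show ?thesis
    by (intro exI[of "\<lambda>a. \<exists>b. _ a b" a] exI[of _ b]) simp
qed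

text \<open>Entrywise restriction changes no value on \<open>S\<close>, and a compact subset of the
  subspace missing \<open>E \<inter> S\<close> is a compact subset of \<open>X\<close> missing
  \<open>E\<close>; so the same sequences serve.\<close>

lemma R_class_restrict:
  assumes f: "f \<in> R_class X A E" and S: "S \<subseteq> topspace X"
  shows "restrict f S \<in> R_class (subtopology X S) (restrict_algebra A S) (E \<inter> S)"
proof -
  obtain H K :: "nat \<Rightarrow> ('a \<Rightarrow> complex) list" where HK:
      "\<And>n. set (H n) \<subseteq> A \<and> set (K n) \<subseteq> A \<and> length (H n) = length (K n)"
      "\<And>n w. w \<in> topspace X \<Longrightarrow> tuple_norm (K n) w \<le> f w \<and> ereal (f w) \<le> 1 / ereal (tuple_norm (H n) w)"
      "\<And>C. compactin X C \<and> C \<subseteq> topspace X - E \<Longrightarrow>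
       uniform_limit C (\<lambda>n. tuple_dot (H n) (K n)) (\<lambda>_. 1) sequentially"
    using f unfolding R_class_def by blast
  define \<rho> :: "('a \<Rightarrow> complex) list \<Rightarrow> ('a \<Rightarrow> complex) list" where "\<rho> = map (\<lambda>a. restrict a S)"
  have top: "topspace (subtopology X S) = S"
    using S by auto
  have norm: "tuple_norm (\<rho> L) w = tuple_norm L w" if "w \<in> S" for L w
    using that unfolding \<rho>_def tuple_norm_def by simp
  have dot: "tuple_dot (\<rho> L) (\<rho> L') w = tuple_dot L L' w" if "w \<in> S" "length L = length L'" for L L' w
    using that unfolding \<rho>_def tuple_dot_def by simp
  have "continuous_map (subtopology X S) euclidean f"
    using R_class_continuous[OF f] continuous_map_from_subtopology by blast
  then have "continuous_map (subtopology X S) euclidean (restrict f S)"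
    by (rule continuous_map_eq) (simp add: top)
  then have "restrict f S \<in> cont_funs (subtopology X S)"
    unfolding cont_funs_def top by simp
  moreover have "restrict f S w = 0 \<longleftrightarrow> w \<in> E \<inter> S" if "w \<in> S" for w
    using R_class_zero_iff[OF f] S that by auto
  moreover have "set (\<rho> (H n)) \<subseteq> restrict_algebra A S \<and> set (\<rho> (K n)) \<subseteq> restrict_algebra A S \<and>
      length (\<rho> (H n)) = length (\<rho> (K n))" for n
    using HK(1)[of n] unfolding \<rho>_def restrict_algebra_def by auto
  moreover have "tuple_norm (\<rho> (K n)) w \<le> restrict f S w \<and>
      ereal (restrict f S w) \<le> 1 / ereal (tuple_norm (\<rho> (H n)) w)" if "w \<in> S" for n w
    using HK(2)[of w n] S norm that by (simp add: subset_iff)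
  moreover have "uniform_limit C (\<lambda>n. tuple_dot (\<rho> (H n)) (\<rho> (K n))) (\<lambda>_. 1) sequentially"
    if C: "compactin (subtopology X S) C \<and> C \<subseteq> S - E \<inter> S" for C
  proof -
    have "compactin X C \<and> C \<subseteq> topspace X - E"
      using C S by (auto simp: compactin_subtopology)
    note HK(3)[OF this]
    moreover have "tuple_dot (\<rho> (H n)) (\<rho> (K n)) w = tuple_dot (H n) (K n) w" if "w \<in> C" for n w
      using dot[of w "H n" "K n"] that C HK(1)[of n] by blast
    ultimately show ?thesis
      by (simp add: uniform_limit_iff)
  qed
  ultimately show ?thesis
    using R_classI[of "restrict f S" "subtopology X S" "E \<inter> S" "\<lambda>n. \<rho> (H n)"
        "restrict_algebra A S" "\<lambda>n. \<rho> (K n)"] unfolding top by presburger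
qed

section \<open>Extrema of \<open>f\<close> on a closed boundary\<close>

lemma R_class_max_on_closed_boundary:
  assumes comp: "compact_space X" and A: "uniform_algebra X A"
    and B: "closed_boundary X A B" and f: "f \<in> R_class X A E"
  shows "\<exists>x\<in>B. \<forall>w\<in>topspace X. f w \<le> f x"
proof -
  have "B \<noteq> {}"
    using B algebra_const[OF A, of 0] unfolding closed_boundary_def by blast
  have BX: "B \<subseteq> topspace X" and "compactin X B"
    using B closedin_subset closedin_compact_space[OF comp] unfolding closed_boundary_def by auto
  then obtain x where x: "x \<in> B" "\<And>y. y \<in> B \<Longrightarrow> f y \<le> f x"
    using compactin_attains_sup[OF _ \<open>B \<noteq> {}\<close> R_class_continuous[OF f]] by blast
  have fx: "f x \<ge> 0"
    using R_class_nonneg[OF f] x(1) BX by blast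
  have "f v \<le> f x" if v: "v \<in> topspace X" for v
  proof (cases "v \<in> E")
    case True
    then show ?thesis using R_class_zero_iff[OF f v] fx by simp
  next
    case False
    have fv: "f v > 0"
      using R_class_pos[OF f v False] .
    obtain a where a: "\<forall>n. a n \<in> A" "\<forall>n. \<forall>w\<in>topspace X. cmod (a n w) \<le> f w / f v"
        "(\<lambda>n. a n v) \<longlonglongrightarrow> 1"
      using R_class_peaking[OF A f v False] by (elim exE conjE)
    have "cmod (a n v) \<le> f x / f v" for n
    proof -
      obtain y where y: "y \<in> B" "\<forall>w\<in>topspace X. cmod (a n w) \<le> cmod (a n y)"
        using B a(1) unfolding closed_boundary_def by blast
      have "cmod (a n v) \<le> cmod (a n y)"
        using y(2) v by blast
      also have "\<dots> \<le> f y / f v"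
        using a(2) y(1) BX by blast
      also have "\<dots> \<le> f x / f v"
        using x(2)[OF y(1)] fv by (simp add: divide_right_mono)
      finally show ?thesis .
    qed
    then have "cmod 1 \<le> f x / f v"
      by (intro LIMSEQ_le_const2[OF tendsto_norm[OF a(3)]]) auto
    then show ?thesis
      using fv by (simp add: field_simps)
  qed
  then show ?thesis
    using x(1) by blast
qed

lemma R_class_min_on_closed_boundary:
  assumes comp: "compact_space X" and A: "uniform_algebra X A"
    and B: "closed_boundary X A B" and f: "f \<in> R_class X A E"
  shows "\<exists>x\<in>B. \<forall>w\<in>topspace X. f x \<le> f w"
proof -
  have "B \<noteq> {}"
    using B algebra_const[OF A, of 0] unfolding closed_boundary_def by blast
  have BX: "B \<subseteq> topspace X" and compB: "compactin X B"
    using B closedin_subset closedin_compact_space[OF comp] unfolding closed_boundary_def by auto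
  have "continuous_map X euclidean (\<lambda>x. - f x)"
    using R_class_continuous[OF f] by (rule continuous_map_minus)
  from compactin_attains_sup[OF compB \<open>B \<noteq> {}\<close> this]
  obtain x where x: "x \<in> B" "\<And>y. y \<in> B \<Longrightarrow> f x \<le> f y"
    by auto
  have xX: "x \<in> topspace X"
    using x(1) BX by blast
  have "f x \<le> f v" if v: "v \<in> topspace X" for v
  proof (cases "f x = 0")
    case True
    then show ?thesis using R_class_nonneg[OF f v] by simp
  next
    case fx0: False
    then have fx: "f x > 0"
      using R_class_nonneg[OF f xX] by simp
    have disj: "B \<inter> E = {}"
      using x(2) fx R_class_zero_iff[OF f] BX by (force simp: disjoint_iff)
    show ?thesis
    proof (cases "v \<in> E")
      case True
      obtain H K where HK:
        "\<And>n. set (H n) \<subseteq> A" "\<And>n. set (K n) \<subseteq> A" "\<And>n. length (H n) = length (K n)"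
        "\<And>n w. w \<in> topspace X \<Longrightarrow> tuple_norm (K n) w \<le> f w"
        "\<And>n w. w \<in> topspace X \<Longrightarrow> f w * tuple_norm (H n) w \<le> 1"
        "\<And>C. compactin X C \<Longrightarrow> C \<inter> E = {} \<Longrightarrow>
           uniform_limit C (\<lambda>n. tuple_dot (H n) (K n)) (\<lambda>_. 1) sequentially"
        using R_class_pair[OF f] by blast
      obtain n where n: "\<And>y. y \<in> B \<Longrightarrow> dist (tuple_dot (H n) (K n) y) 1 < 1"
        using uniform_limitD[OF HK(6)[OF compB disj], of 1] unfolding eventually_sequentially by auto
      \<comment> \<open>\<open>p\<close> is \<open>1 - tuple_dot (H n) (K n)\<close>. Its modulus is
        below 1 on \<open>B\<close>, hence at \<open>v\<close>, but \<open>f v = 0\<close> forces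
        \<open>K n\<close> to vanish at \<open>v\<close>, so that \<open>p v = 1\<close>. The case
        \<open>v \<in> E\<close> is therefore contradictory.\<close>
      define p where "p = (\<lambda>w\<in>topspace X. (-1) * restrict (tuple_dot (H n) (K n)) (topspace X) w + 1)"
      have p: "p w = 1 - tuple_dot (H n) (K n) w" if "w \<in> topspace X" for w
        using that unfolding p_def by simp
      have "p \<in> A"
        unfolding p_def using algebra_affine[OF A algebra_tuple_dot[OF A HK(1-3)]] .
      then obtain y where y: "y \<in> B" "\<forall>w\<in>topspace X. cmod (p w) \<le> cmod (p y)"
        using B unfolding closed_boundary_def by blast
      have "cmod (p v) \<le> cmod (p y)"
        using y(2) v by blast
      also have "\<dots> < 1"
        using n[OF y(1)] p[of y] y(1) BX by (auto simp: dist_norm norm_minus_commute)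
      finally have "cmod (p v) < 1" .
      moreover have "tuple_norm (K n) v = 0"
        using HK(4)[OF v, of n] R_class_zero_iff[OF f v] True tuple_norm_nonneg[of "K n" v] by simp
      then have "tuple_dot (H n) (K n) v = 0"
        using norm_tuple_dot_le[OF HK(3), of n v v] by (simp add: tuple_dot_def HK(3))
      ultimately show ?thesis
        using p[OF v] by simp
    next
      case False
      obtain b where b: "\<forall>n. b n \<in> A" "\<forall>n. \<forall>w\<in>topspace X. cmod (b n w) * f w \<le> f v"
          "(\<lambda>n. b n v) \<longlonglongrightarrow> 1"
        using R_class_peaking[OF A f v False] by (elim exE conjE)
      have "cmod (b n v) \<le> f v / f x" for n
      proof -
        obtain y where y: "y \<in> B" "\<forall>w\<in>topspace X. cmod (b n w) \<le> cmod (b n y)"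
          using B b(1) unfolding closed_boundary_def by blast
        have "cmod (b n v) * f x \<le> cmod (b n y) * f y"
          using y(2) v x(2)[OF y(1)] fx by (intro mult_mono) auto
        also have "\<dots> \<le> f v"
          using b(2) y(1) BX by blast
        finally show ?thesis
          using fx by (simp add: field_simps)
      qed
      then have "cmod 1 \<le> f v / f x"
        by (intro LIMSEQ_le_const2[OF tendsto_norm[OF b(3)]]) auto
      then show ?thesis
        using fx by (simp add: field_simps)
    qed
  qed
  then show ?thesis
    using x(1) by blast
qed

subsection \<open>Analytic functions of several variables\<close>

lemma norm_vector_scalar_mult: "norm (c *s v) = cmod c * norm (v :: complex ^ 'n)"
  by (simp add: norm_vec_def norm_mult L2_set_right_distrib)

lemma bounded_linear_vector_scalar_mult_left:
  "bounded_linear (\<lambda>\<zeta>. \<zeta> *s (v :: complex ^ 'n))"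
  by (rule bounded_linear_intro[of _ "norm v"])
     (auto simp: vec_eq_iff algebra_simps norm_vector_scalar_mult)

text \<open>Replaces the existential derivative by \<open>frechet_derivative\<close>, so that it can
  be treated as a function of the base point and differentiated again.\<close>

lemma analytic_several_has_derivative:
  assumes "analytic_several_on F U" "z \<in> U"
  shows "(F has_derivative frechet_derivative F (at z)) (at z)"
    and "frechet_derivative F (at z) (c *s v) = c * frechet_derivative F (at z) v"
proof -
  obtain F' where F': "(F has_derivative F') (at z)" "\<forall>c v. F' (c *s v) = c * F' v"
    using assms unfolding analytic_several_on_def by blast
  then have "F' = frechet_derivative F (at z)"
    using frechet_derivative_at by blast
  then show "(F has_derivative frechet_derivative F (at z)) (at z)"
    and "frechet_derivative F (at z) (c *s v) = c * frechet_derivative F (at z) v"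
    using F' by simp_all
qed

lemma analytic_several_continuous_on:
  "analytic_several_on F U \<Longrightarrow> continuous_on U F"
  by (meson analytic_several_has_derivative(1) continuous_at_imp_continuous_on has_derivative_continuous)

lemma analytic_several_subset:
  "analytic_several_on F U \<Longrightarrow> open V \<Longrightarrow> V \<subseteq> U \<Longrightarrow> analytic_several_on F V"
  unfolding analytic_several_on_def by blast

lemma analytic_several_local:
  assumes "open U" "\<And>z. z \<in> U \<Longrightarrow> \<exists>V. z \<in> V \<and> analytic_several_on F V"
  shows "analytic_several_on F U"
  using assms unfolding analytic_several_on_def by meson

lemma analytic_several_mult:
  assumes F: "analytic_several_on F U" and G: "analytic_several_on G U"
  shows "analytic_several_on (\<lambda>z. F z * G z) U"
  unfolding analytic_several_on_def
proof (intro conjI ballI)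
  show "open U" using F unfolding analytic_several_on_def by blast
  fix z assume z: "z \<in> U"
  note d = analytic_several_has_derivative[OF F z] analytic_several_has_derivative[OF G z]
  show "\<exists>F'. ((\<lambda>z. F z * G z) has_derivative F') (at z) \<and> (\<forall>c v. F' (c *s v) = c * F' v)"
    by (rule exI, rule conjI, rule has_derivative_mult[OF d(1,3)]) (simp add: d(2,4) algebra_simps)
qed

lemma analytic_several_compose:
  assumes F: "analytic_several_on F U" and g: "g holomorphic_on S" "open S" "F ` U \<subseteq> S"
  shows "analytic_several_on (\<lambda>z. g (F z)) U"
  unfolding analytic_several_on_def
proof (intro conjI ballI)
  show "open U" using F unfolding analytic_several_on_def by blast
  fix z assume z: "z \<in> U"
  note d = analytic_several_has_derivative[OF F z]
  have g': "(g has_derivative (*) (deriv g (F z))) (at (F z))"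
    using holomorphic_derivI[OF g(1,2)] z g(3) by (auto simp: has_field_derivative_def)
  show "\<exists>F'. ((\<lambda>z. g (F z)) has_derivative F') (at z) \<and> (\<forall>c v. F' (c *s v) = c * F' v)"
    by (rule exI, rule conjI, rule has_derivative_compose[OF d(1) g']) (simp add: d(2))
qed

lemma analytic_several_translate:
  assumes F: "analytic_several_on F U" "open V" "\<And>z. z \<in> V \<Longrightarrow> z + t \<in> U"
  shows "analytic_several_on (\<lambda>z. F (z + t)) V"
  unfolding analytic_several_on_def
proof (intro conjI ballI)
  show "open V" by fact
  fix z assume z: "z \<in> V"
  note d = analytic_several_has_derivative[OF F(1) F(3)[OF z]]
  have t: "((\<lambda>z. z + t) has_derivative (\<lambda>h. h)) (at z)"
    by (auto intro!: derivative_eq_intros)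
  show "\<exists>F'. ((\<lambda>z. F (z + t)) has_derivative F') (at z) \<and> (\<forall>c v. F' (c *s v) = c * F' v)"
    by (rule exI, rule conjI, rule has_derivative_compose[OF t d(1)]) (simp add: d(2))
qed

lemma analytic_several_diff:
  assumes F: "analytic_several_on F U" and G: "analytic_several_on G U"
  shows "analytic_several_on (\<lambda>z. F z - G z) U"
  unfolding analytic_several_on_def
proof (intro conjI ballI)
  show "open U" using F unfolding analytic_several_on_def by blast
  fix z assume z: "z \<in> U"
  note d = analytic_several_has_derivative[OF F z] analytic_several_has_derivative[OF G z]
  show "\<exists>F'. ((\<lambda>z. F z - G z) has_derivative F') (at z) \<and> (\<forall>c v. F' (c *s v) = c * F' v)"
    by (rule exI, rule conjI, rule has_derivative_diff[OF d(1,3)]) (simp add: d(2,4) algebra_simps)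
qed

section \<open>Complex lines, Cauchy estimates and limits\<close>

lemma analytic_several_line_has_field_derivative:
  assumes F: "analytic_several_on F U" and U: "z + \<zeta> *s v \<in> U"
  shows "((\<lambda>\<zeta>. F (z + \<zeta> *s v)) has_field_derivative frechet_derivative F (at (z + \<zeta> *s v)) v) (at \<zeta>)"
proof -
  note d = analytic_several_has_derivative[OF F U]
  have "((\<lambda>\<zeta>. z + \<zeta> *s v) has_derivative (\<lambda>h. h *s v)) (at \<zeta>)"
    using bounded_linear.has_derivative[OF bounded_linear_vector_scalar_mult_left has_derivative_ident]
    by (auto intro!: derivative_eq_intros)
  from has_derivative_compose[OF this d(1)] show ?thesis
    \<comment> \<open>Complex linearity \<open>d(2)\<close> is what makes the derivative of the
      slice multiplication by one complex number.\<close>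
    unfolding has_field_derivative_def by (simp add: d(2) mult_commute_abs)
qed

lemma analytic_several_line_holomorphic:
  assumes F: "analytic_several_on F U" and "\<And>\<zeta>. \<zeta> \<in> S \<Longrightarrow> z + \<zeta> *s v \<in> U"
  shows "(\<lambda>\<zeta>. F (z + \<zeta> *s v)) holomorphic_on S"
proof (rule holomorphic_onI)
  fix \<zeta> assume "\<zeta> \<in> S"
  from analytic_several_line_has_field_derivative[OF F assms(2)[OF this]]
  have "(\<lambda>\<zeta>. F (z + \<zeta> *s v)) field_differentiable at \<zeta>"
    unfolding field_differentiable_def by blast
  then show "(\<lambda>\<zeta>. F (z + \<zeta> *s v)) field_differentiable at \<zeta> within S"
    by (rule field_differentiable_at_within)
qed

lemma line_in_ball:
  fixes v :: "complex ^ 'n"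
  assumes "cmod \<zeta> * norm v < r"
  shows "z + \<zeta> *s v \<in> ball z r"
  using assms by (simp add: dist_norm norm_vector_scalar_mult)

lemma analytic_several_derivative_bound:
  assumes F: "analytic_several_on F U" and r: "0 < r" "ball z r \<subseteq> U"
    and M: "\<And>w. w \<in> ball z r \<Longrightarrow> cmod (F w) \<le> M"
  shows "cmod (frechet_derivative F (at z) v) \<le> 2 * M / r * norm v"
proof (cases "v = 0")
  case True
  then show ?thesis
    using analytic_several_has_derivative(2)[OF F subsetD[OF r(2)], of z 0 v] r(1) by simp
next
  case False
  \<comment> \<open>Half of the largest admissible radius on the line in direction \<open>v\<close>,
    so that the closed disc stays inside the open ball; this is the origin of the factor 2 in the
    bound.\<close>
  define s where "s = r / (2 * norm v)"
  have s: "s > 0" using False r unfolding s_def by simp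
  have inball: "z + \<zeta> *s v \<in> ball z r" if "cmod \<zeta> \<le> s" for \<zeta>
  proof (rule line_in_ball)
    have "cmod \<zeta> * norm v \<le> s * norm v"
      using that by (intro mult_right_mono) auto
    also have "\<dots> < r"
      using False r unfolding s_def by (simp add: field_simps)
    finally show "cmod \<zeta> * norm v < r" .
  qed
  let ?\<phi> = "\<lambda>\<zeta>. F (z + \<zeta> *s v)"
  have hol: "?\<phi> holomorphic_on cball 0 s"
    by (rule analytic_several_line_holomorphic[OF F]) (use inball r(2) in auto)
  have "cmod ((deriv ^^ 1) ?\<phi> 0) \<le> fact 1 * M / s ^ 1"
  proof (rule Cauchy_inequality)
    show "?\<phi> holomorphic_on ball 0 s"
      using hol ball_subset_cball holomorphic_on_subset by blast
    show "continuous_on (cball 0 s) ?\<phi>"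
      using hol holomorphic_on_imp_continuous_on by blast
  qed (use s inball M in auto)
  moreover have "deriv ?\<phi> 0 = frechet_derivative F (at z) v"
    using DERIV_imp_deriv[OF analytic_several_line_has_field_derivative[OF F, of z 0 v]] subsetD[OF r(2), of z] r(1) by simp
  ultimately show ?thesis
    using s False unfolding s_def by (simp add: field_simps)
qed

text \<open>Weierstrass' theorem. Cauchy's estimate applied to \<open>F n - F m\<close> makes the
  derivatives uniformly Cauchy on a smaller ball, so \<open>has_derivative_sequence\<close>
  differentiates the limit; complex linearity passes to the limit pointwise.\<close>

lemma analytic_several_uniform_limit:
  assumes F: "\<And>n. analytic_several_on (F n) U" and lim: "uniform_limit U F G sequentially"
  shows "analytic_several_on G U"
proof -
  have U: "open U" using F unfolding analytic_several_on_def by blast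
  have "\<exists>F'. (G has_derivative F') (at z) \<and> (\<forall>c v. F' (c *s v) = c * F' v)" if z: "z \<in> U" for z
  proof -
    obtain r where r: "r > 0" "ball z (2 * r) \<subseteq> U"
      using U z by (metis open_contains_ball field_sum_of_halves half_gt_zero mult_2)
    have sub: "ball x r \<subseteq> ball z (2 * r)" if "x \<in> ball z r" for x
    proof
      fix y assume "y \<in> ball x r"
      then show "y \<in> ball z (2 * r)"
        using that dist_triangle[of z y x] by simp
    qed
    have inU: "x \<in> U" if "x \<in> ball z r" for x
      using that r by auto
    define D where "D n x = frechet_derivative (F n) (at x)" for n x
    have Cauchy_bound: "cmod (D n x v - D m x v) \<le> 2 * e / r * norm v"
      if "x \<in> ball z r" "\<And>w. w \<in> U \<Longrightarrow> cmod (F n w - F m w) \<le> e" for n m x v e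
    proof -
      have "((\<lambda>w. F n w - F m w) has_derivative (\<lambda>v. D n x v - D m x v)) (at x)"
        unfolding D_def by (intro has_derivative_diff analytic_several_has_derivative(1)[OF F inU] that)
      then have "(\<lambda>v. D n x v - D m x v) = frechet_derivative (\<lambda>w. F n w - F m w) (at x)"
        by (rule frechet_derivative_at)
      moreover have "cmod (frechet_derivative (\<lambda>w. F n w - F m w) (at x) v) \<le> 2 * e / r * norm v"
        using that(2) sub[OF that(1)] r
        by (intro analytic_several_derivative_bound[OF analytic_several_diff[OF F F]]) blast+
      ultimately show ?thesis
        by metis
    qed
    have Cauchy_U: "\<exists>N. \<forall>n\<ge>N. \<forall>m\<ge>N. \<forall>w\<in>U. cmod (F n w - F m w) \<le> e" if "e > 0" for e
    proof -
      have "uniformly_Cauchy_on U F"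
        using lim uniformly_convergent_Cauchy uniformly_convergent_on_def by blast
      then show ?thesis
        using that unfolding uniformly_Cauchy_on_def dist_norm by (meson less_imp_le)
    qed
    \<comment> \<open>The bound is proportional to \<open>norm v\<close>, that is, in operator norm;
      this is the form \<open>has_derivative_sequence\<close> asks for.\<close>
    have D_Cauchy: "\<exists>N. \<forall>n\<ge>N. \<forall>m\<ge>N. \<forall>x\<in>ball z r. \<forall>v. cmod (D n x v - D m x v) \<le> e * norm v" if e: "e > 0" for e
    proof -
      obtain N where N: "\<forall>n\<ge>N. \<forall>m\<ge>N. \<forall>w\<in>U. cmod (F n w - F m w) \<le> e * r / 2"
        using Cauchy_U[of "e * r / 2"] mult_pos_pos[OF e r(1)] by auto
      have "cmod (D n x v - D m x v) \<le> e * norm v" if "n \<ge> N" "m \<ge> N" "x \<in> ball z r" for n m x v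
        using Cauchy_bound[OF that(3), of n m "e * r / 2" v] N that(1,2) r(1) by auto
      then show ?thesis by blast
    qed
    have "convergent (\<lambda>n. D n x v)" if x: "x \<in> ball z r" for x v
    proof (intro Cauchy_convergent metric_CauchyI)
      fix e :: real assume "e > 0"
      then have "e / (norm v + 1) > 0"
        by (simp add: add_nonneg_pos)
      then obtain N where N: "\<forall>n\<ge>N. \<forall>m\<ge>N. \<forall>x\<in>ball z r. \<forall>v'. cmod (D n x v' - D m x v') \<le> e / (norm v + 1) * norm v'"
        using D_Cauchy by blast
      have "e / (norm v + 1) * norm v < e"
        using \<open>e > 0\<close> pos_divide_less_eq[of "norm v + 1" "e * norm v" e]
        by (simp add: add_nonneg_pos distrib_left)
      then show "\<exists>N. \<forall>m\<ge>N. \<forall>n\<ge>N. dist (D m x v) (D n x v) < e"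
        using N x unfolding dist_norm by (meson le_less_trans)
    qed
    then obtain L where L: "\<And>x v. x \<in> ball z r \<Longrightarrow> (\<lambda>n. D n x v) \<longlonglongrightarrow> L x v"
      unfolding convergent_def by metis
    have "\<exists>g. \<forall>x\<in>ball z r. (\<lambda>n. F n x) \<longlonglongrightarrow> g x \<and> (g has_derivative L x) (at x within ball z r)"
    proof (rule has_derivative_sequence)
      show "convex (ball z r)" by simp
      show "(F n has_derivative D n x) (at x within ball z r)" if "x \<in> ball z r" for n x
        unfolding D_def using analytic_several_has_derivative(1)[OF F inU[OF that]] has_derivative_at_withinI by blast
      show "\<forall>\<^sub>F n in sequentially. \<forall>x\<in>ball z r. \<forall>h. cmod (D n x h - L x h) \<le> e * norm h" if e: "e > 0" for e
      proof -
        obtain N where N: "\<And>n m x v. n \<ge> N \<Longrightarrow> m \<ge> N \<Longrightarrow> x \<in> ball z r \<Longrightarrow> cmod (D n x v - D m x v) \<le> e * norm v"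
          using D_Cauchy[OF e] by blast
        have "cmod (D n x h - L x h) \<le> e * norm h" if "n \<ge> N" "x \<in> ball z r" for n x h
          by (rule LIMSEQ_le_const2[OF tendsto_norm[OF tendsto_diff[OF tendsto_const L[OF that(2)]]]])
             (use N that in blast)
        then show ?thesis
          unfolding eventually_sequentially by blast
      qed
      show "z \<in> ball z r" using r by simp
      show "(\<lambda>n. F n z) \<longlonglongrightarrow> G z"
        using tendsto_uniform_limitI[OF lim z] .
    qed
    then obtain g where g: "\<And>x. x \<in> ball z r \<Longrightarrow> (\<lambda>n. F n x) \<longlonglongrightarrow> g x"
        "\<And>x. x \<in> ball z r \<Longrightarrow> (g has_derivative L x) (at x within ball z r)"
      by blast
    have zb: "z \<in> ball z r" using r by simp
    have "g x = G x" if "x \<in> ball z r" for x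
      using g(1)[OF that] tendsto_uniform_limitI[OF lim inU[OF that]] LIMSEQ_unique by blast
    moreover have "(g has_derivative L z) (at z)"
      using g(2)[OF zb] at_within_open[OF zb] by simp
    ultimately have "(G has_derivative L z) (at z)"
      using has_derivative_transform_within_open[OF _ open_ball zb] by blast
    moreover have "L z (c *s v) = c * L z v" for c v
    proof (rule LIMSEQ_unique[OF L[OF zb]])
      have "D n z (c *s v) = c * D n z v" for n
        unfolding D_def by (rule analytic_several_has_derivative(2)[OF F z])
      then show "(\<lambda>n. D n z (c *s v)) \<longlonglongrightarrow> c * L z v"
        using tendsto_mult[OF tendsto_const L[OF zb]] by simp
    qed
    ultimately show ?thesis by blast
  qed
  then show ?thesis
    unfolding analytic_several_on_def using U by blast
qed

text \<open>Taylor's formula of order 1. Points of \<open>ball 0 (s / 2)\<close> are centres of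
  discs of radius \<open>s / 4\<close> inside \<open>ball 0 s\<close>, so Cauchy's inequality bounds
  the second derivative by \<open>2 * M / (s / 4)\<^sup>2\<close>, whence the 32.\<close>

lemma holomorphic_linear_approximation:
  assumes hol: "\<phi> holomorphic_on ball 0 s" and s: "s > 0"
    and M: "\<And>\<zeta>. \<zeta> \<in> ball 0 s \<Longrightarrow> cmod (\<phi> \<zeta>) \<le> M" and \<zeta>: "cmod \<zeta> < s / 2"
  shows "cmod (\<phi> \<zeta> - \<phi> 0 - deriv \<phi> 0 * \<zeta>) \<le> 32 * M / s\<^sup>2 * (cmod \<zeta>)\<^sup>2"
proof -
  define f where "f i = (deriv ^^ i) \<phi>" for i
  have "cmod (f 0 \<zeta> - (\<Sum>i\<le>1. f i 0 * (\<zeta> - 0) ^ i / fact i)) \<le> 32 * M / s\<^sup>2 * cmod (\<zeta> - 0) ^ Suc 1 / fact 1"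
  proof (rule complex_Taylor[of "ball 0 (s / 2)"])
    show "(f i has_field_derivative f (Suc i) x) (at x within ball 0 (s / 2))" if "x \<in> ball 0 (s / 2)" for i x
      unfolding f_def
      by (rule has_field_derivative_at_within[OF has_field_derivative_higher_deriv[OF hol]]) (use that s in auto)
    show "cmod (f (Suc 1) x) \<le> 32 * M / s\<^sup>2" if x: "x \<in> ball 0 (s / 2)" for x
    proof -
      have sub: "cball x (s / 4) \<subseteq> ball 0 s"
      proof
        fix y assume "y \<in> cball x (s / 4)"
        then show "y \<in> ball 0 s"
          using x s dist_triangle[of 0 y x] by simp
      qed
      have "cmod ((deriv ^^ 2) \<phi> x) \<le> fact 2 * M / (s / 4) ^ 2"
      proof (rule Cauchy_inequality)
        show "\<phi> holomorphic_on ball x (s / 4)"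
          using hol sub ball_subset_cball holomorphic_on_subset by blast
        show "continuous_on (cball x (s / 4)) \<phi>"
          using hol sub holomorphic_on_imp_continuous_on continuous_on_subset by blast
        show "cmod (\<phi> y) \<le> M" if "norm (x - y) = s / 4" for y
          using M sub that by (auto simp: subset_iff dist_norm)
      qed (use s in auto)
      then show ?thesis
        unfolding f_def by (simp add: numeral_2_eq_2 power_divide)
    qed
  qed (use s \<zeta> in auto)
  then show ?thesis
    unfolding f_def by (simp add: power2_eq_square algebra_simps)
qed

text \<open>
  The directional derivative is a locally uniform limit of difference quotients, which spares
  differentiating a Cauchy integral.
\<close>

lemma analytic_several_frechet_derivative:
  assumes F: "analytic_several_on F U"
  shows "analytic_several_on (\<lambda>z. frechet_derivative F (at z) v) U"
proof (rule analytic_several_local)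
  show U: "open U" using F unfolding analytic_several_on_def by blast
  fix z assume z: "z \<in> U"
  have "continuous (at z) F"
    using analytic_several_continuous_on[OF F] U z continuous_on_eq_continuous_at by blast
  then obtain d where d: "d > 0" "\<And>w. dist w z < d \<Longrightarrow> dist (F w) (F z) < 1"
    unfolding continuous_at_eps_delta by (meson zero_less_one)
  obtain e where e: "e > 0" "ball z e \<subseteq> U"
    using U z open_contains_ball by blast
  define r where "r = min d e / 2"
  define M where "M = cmod (F z) + 1"
  have r: "r > 0" "ball z (2 * r) \<subseteq> U"
    using d e unfolding r_def by auto
  have M: "cmod (F w) \<le> M" if "w \<in> ball z (2 * r)" for w
  proof -
    have "cmod (F w - F z) < 1"
      using d(2)[of w] that unfolding r_def by (simp add: dist_norm norm_minus_commute)
    then show ?thesis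
      using norm_triangle_ineq2[of "F w" "F z"] unfolding M_def by simp
  qed
  \<comment> \<open>The added 1 covers \<open>v = 0\<close>; steps of modulus below \<open>s\<close>
    along \<open>v\<close> lead from \<open>ball z r\<close> into \<open>ball z (2 * r)\<close>,
    where \<open>F\<close> is bounded by \<open>M\<close>.\<close>
  define s where "s = r / (norm v + 1)"
  have s: "s > 0" using r unfolding s_def by (simp add: add_nonneg_pos)
  have sv: "s * norm v < r"
    using r(1) pos_divide_less_eq[of "norm v + 1" "r * norm v" r]
    unfolding s_def by (simp add: add_nonneg_pos distrib_left)
  have inball: "w + \<zeta> *s v \<in> ball z (2 * r)" if w: "w \<in> ball z r" and \<zeta>: "cmod \<zeta> < s" for w \<zeta>
  proof -
    have "cmod \<zeta> * norm v \<le> s * norm v"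
      using \<zeta> by (intro mult_right_mono) auto
    then have "w + \<zeta> *s v \<in> ball w r"
      using sv by (intro line_in_ball) auto
    then show ?thesis
      using w dist_triangle[of z "w + \<zeta> *s v" w] by simp
  qed
  \<comment> \<open>The index shift makes every step size \<open>t k\<close> less than
    \<open>s / 2\<close>, so that all difference quotients, not only late ones, are analytic on
    \<open>ball z r\<close>.\<close>
  obtain k0 :: nat where k0: "2 / s < real k0"
    using reals_Archimedean2 by blast
  define t where "t k = 1 / real (k + k0)" for k
  have k0': "real k0 > 0"
    using k0 s by (meson divide_pos_pos less_trans zero_less_numeral)
  have t: "t k > 0" "t k < s / 2" for k
  proof -
    show "t k > 0" using k0' unfolding t_def by simp
    have "2 / s < real (k + k0)" using k0 by simp
    then show "t k < s / 2"
      using s k0' unfolding t_def by (simp add: field_simps)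
  qed
  define Q where "Q k w = of_real (1 / t k) * (F (w + of_real (t k) *s v) - F w)" for k w
  have "analytic_several_on (\<lambda>z. frechet_derivative F (at z) v) (ball z r)"
  proof (rule analytic_several_uniform_limit)
    fix k
    have "analytic_several_on (\<lambda>w. F (w + of_real (t k) *s v) - F w) (ball z r)"
    proof (rule analytic_several_diff)
      show "analytic_several_on (\<lambda>w. F (w + of_real (t k) *s v)) (ball z r)"
      proof (rule analytic_several_translate[OF F open_ball])
        show "w + of_real (t k) *s v \<in> U" if "w \<in> ball z r" for w
          using inball[OF that, of "of_real (t k)"] t[of k] r(2) s by auto
      qed
      show "analytic_several_on F (ball z r)"
        using r by (intro analytic_several_subset[OF F]) auto
    qed
    then show "analytic_several_on (Q k) (ball z r)"
      unfolding Q_def by (rule analytic_several_compose[of _ _ _ UNIV]) (auto intro!: holomorphic_intros)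
  next
    have bound: "cmod (Q k w - frechet_derivative F (at w) v) \<le> 32 * M / s\<^sup>2 * t k" if w: "w \<in> ball z r" for k w
    proof -
      let ?\<phi> = "\<lambda>\<zeta>. F (w + \<zeta> *s v)"
      have wU: "w \<in> U" using w r by auto
      have D: "deriv ?\<phi> 0 = frechet_derivative F (at w) v"
        using DERIV_imp_deriv[OF analytic_several_line_has_field_derivative[OF F, of w 0 v]] wU by auto
      have "cmod (?\<phi> (of_real (t k)) - ?\<phi> 0 - deriv ?\<phi> 0 * of_real (t k)) \<le> 32 * M / s\<^sup>2 * (cmod (of_real (t k)))\<^sup>2"
      proof (rule holomorphic_linear_approximation[OF _ s])
        show "?\<phi> holomorphic_on ball 0 s"
          by (rule analytic_several_line_holomorphic[OF F]) (use inball[OF w] r in auto)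
        show "cmod (?\<phi> \<zeta>) \<le> M" if "\<zeta> \<in> ball 0 s" for \<zeta>
          using that by (intro M inball[OF w]) auto
        show "cmod (of_real (t k)) < s / 2"
          using t[of k] by simp
      qed
      also have "?\<phi> (of_real (t k)) - ?\<phi> 0 - deriv ?\<phi> 0 * of_real (t k) =
          of_real (t k) * (Q k w - frechet_derivative F (at w) v)"
        using t(1)[of k] unfolding D Q_def by (simp add: field_simps)
      finally have "t k * cmod (Q k w - frechet_derivative F (at w) v) \<le> t k * (32 * M / s\<^sup>2 * t k)"
        using t(1)[of k] by (simp add: norm_mult power2_eq_square mult_ac)
      then show ?thesis
        using t(1)[of k] by (simp only: mult_le_cancel_left_pos)
    qed
    have "t \<longlonglongrightarrow> 0"
      unfolding t_def using LIMSEQ_ignore_initial_segment[OF lim_1_over_n, of k0] by simp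
    then have lim: "(\<lambda>k. 32 * M / s\<^sup>2 * t k) \<longlonglongrightarrow> 0"
      by (rule tendsto_mult_right_zero)
    show "uniform_limit (ball z r) Q (\<lambda>w. frechet_derivative F (at w) v) sequentially"
    proof (rule uniform_limitI)
      fix e :: real assume "e > 0"
      then have "\<forall>\<^sub>F k in sequentially. 32 * M / s\<^sup>2 * t k < e"
        using order_tendstoD(2)[OF lim] by blast
      then show "\<forall>\<^sub>F k in sequentially. \<forall>w\<in>ball z r. dist (Q k w) (frechet_derivative F (at w) v) < e"
      proof eventually_elim
        case (elim k)
        then show ?case
          using bound[of _ k] unfolding dist_norm by (meson le_less_trans)
      qed
    qed
  qed
  then show "\<exists>V. z \<in> V \<and> analytic_several_on (\<lambda>z. frechet_derivative F (at z) v) V"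
    using r(1) by (intro exI[of _ "ball z r"]) auto
qed

subsection \<open>Harmonicity\<close>

text \<open>\<open>- cnj q\<close> is the mirror image of \<open>q\<close> in the imaginary axis,
  and \<open>p\<close> lies on the side of \<open>q\<close>. Hence the quotient used for Harnack's
  inequality maps into the unit disc.\<close>

lemma norm_diff_less_norm_add_cnj:
  assumes "Re p > 0" "Re q > 0"
  shows "cmod (p - q) < cmod (p + cnj q)"
proof -
  have "(cmod (p + cnj q))\<^sup>2 = (cmod (p - q))\<^sup>2 + 4 * (Re p * Re q)"
    unfolding cmod_power2 by (simp add: power2_eq_square algebra_simps)
  then have "(cmod (p - q))\<^sup>2 < (cmod (p + cnj q))\<^sup>2"
    using assms by simp
  then show ?thesis
    using power2_less_imp_less norm_ge_zero by blast
qed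

text \<open>
  Harnack's inequality for \<open>1 - \<phi>\<close>, which has nonnegative real part: apply the Schwarz lemma
  to \<open>(p - p 0) / (p + cnj (p 0))\<close>, where \<open>p = 1 - \<phi> + \<epsilon>\<close>.
\<close>

lemma Harnack_unit_disc:
  assumes hol: "\<phi> holomorphic_on ball 0 1" and le1: "\<And>z. cmod z < 1 \<Longrightarrow> cmod (\<phi> z) \<le> 1"
    and \<zeta>: "cmod \<zeta> \<le> 1 / 2"
  shows "cmod (1 - \<phi> \<zeta>) \<le> 3 * cmod (1 - \<phi> 0)"
proof (rule field_le_epsilon)
  fix e :: real assume "e > 0"
  \<comment> \<open>The shift makes the real part strictly positive. It costs
    \<open>\<epsilon>\<close> at \<open>\<zeta>\<close> and \<open>3 * \<epsilon>\<close> at 0,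
    together \<open>e\<close>.\<close>
  define \<epsilon> where "\<epsilon> = e / 4"
  have \<epsilon>: "\<epsilon> > 0" using \<open>e > 0\<close> unfolding \<epsilon>_def by simp
  define p where "p z = 1 - \<phi> z + of_real \<epsilon>" for z
  have Re_p: "Re (p z) > 0" if "cmod z < 1" for z
    using le1[OF that] complex_Re_le_cmod[of "\<phi> z"] \<epsilon> unfolding p_def by simp
  define q where "q z = (p z - p 0) / (p z + cnj (p 0))" for z
  have ne: "p z + cnj (p 0) \<noteq> 0" if "cmod z < 1" for z
  proof
    assume "p z + cnj (p 0) = 0"
    then have "Re (p z) + Re (p 0) = 0"
      by (metis complex_cnj(1) cnj.sel(1) plus_complex.sel(1) zero_complex.sel(1))
    then show False
      using Re_p[OF that] Re_p[of 0] by simp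
  qed
  have "cmod (q \<zeta>) \<le> cmod \<zeta>"
  proof (rule Schwarz_Lemma(1))
    have "p holomorphic_on ball 0 1"
      unfolding p_def by (intro holomorphic_intros hol)
    then show "q holomorphic_on ball 0 1"
      unfolding q_def using ne by (intro holomorphic_intros) auto
    show "q 0 = 0" unfolding q_def by simp
    show "cmod (q z) < 1" if "cmod z < 1" for z
      using norm_diff_less_norm_add_cnj[OF Re_p[OF that] Re_p[of 0]] ne[OF that]
      unfolding q_def by (simp add: norm_divide)
  qed (use \<zeta> in simp)
  then have "cmod (q \<zeta>) \<le> 1 / 2"
    using \<zeta> by linarith
  then have "cmod (p \<zeta> - p 0) \<le> 1 / 2 * cmod (p \<zeta> + cnj (p 0))"
    using ne[of \<zeta>] \<zeta> unfolding q_def by (simp add: norm_divide divide_le_eq)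
  also have "\<dots> \<le> 1 / 2 * (cmod (p \<zeta>) + cmod (p 0))"
    using norm_triangle_ineq[of "p \<zeta>" "cnj (p 0)"] by simp
  \<comment> \<open>Absorbing half of \<open>cmod (p \<zeta>)\<close> into the left side leaves one
    half against three halves, hence the constant 3.\<close>
  finally have *: "cmod (p \<zeta>) \<le> 3 * cmod (p 0)"
    using norm_triangle_ineq2[of "p \<zeta>" "p 0"] by simp
  have "cmod (1 - \<phi> \<zeta>) \<le> cmod (p \<zeta>) + \<epsilon>"
    using norm_triangle_ineq4[of "p \<zeta>" "of_real \<epsilon>"] \<epsilon> unfolding p_def by simp
  moreover have "cmod (p 0) \<le> cmod (1 - \<phi> 0) + \<epsilon>"
    using norm_triangle_ineq[of "1 - \<phi> 0" "of_real \<epsilon>"] \<epsilon> unfolding p_def by simp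
  ultimately show "cmod (1 - \<phi> \<zeta>) \<le> 3 * cmod (1 - \<phi> 0) + e"
    using * unfolding \<epsilon>_def by simp
qed

lemma analytic_several_Harnack:
  assumes F: "analytic_several_on F (ball w r)" and le1: "\<And>z. z \<in> ball w r \<Longrightarrow> cmod (F z) \<le> 1"
    and z: "z \<in> ball w (r / 2)"
  shows "cmod (1 - F z) \<le> 3 * cmod (1 - F w)"
proof -
  \<comment> \<open>Twice the displacement, so that \<open>z\<close> sits at parameter
    \<open>1 / 2\<close> on a unit disc still contained in the ball.\<close>
  define v where "v = 2 *s (z - w)"
  have in_ball: "w + \<zeta> *s v \<in> ball w r" if "cmod \<zeta> < 1" for \<zeta>
  proof (rule line_in_ball)
    have "norm v < r"
      using z unfolding v_def norm_vector_scalar_mult by (simp add: dist_norm norm_minus_commute)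
    moreover have "cmod \<zeta> * norm v \<le> 1 * norm v"
      using that by (intro mult_right_mono) auto
    ultimately show "cmod \<zeta> * norm v < r" by simp
  qed
  have "cmod (1 - F (w + (1 / 2) *s v)) \<le> 3 * cmod (1 - F (w + 0 *s v))"
  proof (rule Harnack_unit_disc)
    show "(\<lambda>\<zeta>. F (w + \<zeta> *s v)) holomorphic_on ball 0 1"
      by (rule analytic_several_line_holomorphic[OF F]) (use in_ball in auto)
  qed (use in_ball le1 in auto)
  moreover have "w + (1 / 2) *s v = z"
    unfolding v_def by (simp add: vec_eq_iff)
  ultimately show ?thesis by simp
qed

section \<open>Harmonic functions: gluing and partial derivatives\<close>

lemma harmonic_onI:
  fixes u' :: "'v::euclidean_space \<Rightarrow> 'v \<Rightarrow>\<^sub>L real" and u'' :: "'v \<Rightarrow> 'v \<Rightarrow>\<^sub>L 'v \<Rightarrow>\<^sub>L real"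
  assumes "open U"
    and "\<And>x. x \<in> U \<Longrightarrow> (u has_derivative blinfun_apply (u' x)) (at x)"
    and "\<And>x. x \<in> U \<Longrightarrow> (u' has_derivative blinfun_apply (u'' x)) (at x)"
    and "continuous_on U u''"
    and "\<And>x. x \<in> U \<Longrightarrow> (\<Sum>b\<in>Basis. blinfun_apply (blinfun_apply (u'' x) b) b) = 0"
  shows "harmonic_on u U"
  unfolding harmonic_on_def
  by (rule conjI, fact, rule exI[of _ u'], rule exI[of _ u'']) (simp add: assms(2-))

lemma harmonic_onE:
  assumes "harmonic_on u U"
  obtains u' u'' where "open U"
    "\<And>x. x \<in> U \<Longrightarrow> (u has_derivative blinfun_apply (u' x)) (at x)"
    "\<And>x. x \<in> U \<Longrightarrow> (u' has_derivative blinfun_apply (u'' x)) (at x)"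
    "continuous_on U u''"
    "\<And>x. x \<in> U \<Longrightarrow> (\<Sum>b\<in>Basis. blinfun_apply (blinfun_apply (u'' x) b) b) = 0"
proof -
  obtain u' u'' where "open U \<and>
    (\<forall>x\<in>U. (u has_derivative blinfun_apply (u' x)) (at x)) \<and>
    (\<forall>x\<in>U. (u' has_derivative blinfun_apply (u'' x)) (at x)) \<and>
    continuous_on U u'' \<and>
    (\<forall>x\<in>U. (\<Sum>b\<in>Basis. blinfun_apply (blinfun_apply (u'' x) b) b) = 0)"
    using assms unfolding harmonic_on_def by (elim conjE exE) simp
  then show ?thesis
    by (intro that[of u' u'']) simp_all
qed

lemma harmonic_on_cong:
  assumes u: "harmonic_on u U" and eq: "\<And>x. x \<in> U \<Longrightarrow> u x = v x"
  shows "harmonic_on v U"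
  using u
proof (rule harmonic_onE)
  fix u' u''
  assume *: "open U"
    "\<And>x. x \<in> U \<Longrightarrow> (u has_derivative blinfun_apply (u' x)) (at x)"
    "\<And>x. x \<in> U \<Longrightarrow> (u' has_derivative blinfun_apply (u'' x)) (at x)"
    "continuous_on U u''"
    "\<And>x. x \<in> U \<Longrightarrow> (\<Sum>b\<in>Basis. blinfun_apply (blinfun_apply (u'' x) b) b) = 0"
  have "(v has_derivative blinfun_apply (u' x)) (at x)" if "x \<in> U" for x
    using has_derivative_transform_within_open[OF *(2)[OF that] *(1) that eq] .
  then show ?thesis
    using *(1,3-5) by (intro harmonic_onI)
qed

text \<open>The derivative fields in \<open>harmonic_on\<close> are existential, so local choices
  must be glued: each point uses the field chosen for itself, and uniqueness of derivatives makes
  this diagonal choice agree with every local field.\<close>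

lemma harmonic_on_local:
  fixes u :: "'v::euclidean_space \<Rightarrow> real"
  assumes loc: "\<And>x. x \<in> U \<Longrightarrow> \<exists>V. x \<in> V \<and> V \<subseteq> U \<and> harmonic_on u V"
  shows "harmonic_on u U"
proof -
  define Q where "Q x V u' u'' \<longleftrightarrow> x \<in> V \<and> V \<subseteq> U \<and> open V \<and>
      (\<forall>x\<in>V. (u has_derivative blinfun_apply (u' x)) (at x)) \<and>
      (\<forall>x\<in>V. (u' has_derivative blinfun_apply (u'' x)) (at x)) \<and>
      continuous_on V u'' \<and>
      (\<forall>x\<in>V. (\<Sum>b\<in>Basis. blinfun_apply (blinfun_apply (u'' x) b) b) = 0)"
    for x and V and u' :: "'v \<Rightarrow> 'v \<Rightarrow>\<^sub>L real" and u'' :: "'v \<Rightarrow> 'v \<Rightarrow>\<^sub>L 'v \<Rightarrow>\<^sub>L real"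
  have "\<forall>x\<in>U. \<exists>V u' u''. Q x V u' u''"
  proof
    fix x assume "x \<in> U"
    then obtain V where V: "x \<in> V" "V \<subseteq> U" "harmonic_on u V"
      using loc by blast
    from V(3) show "\<exists>V u' u''. Q x V u' u''"
    proof (rule harmonic_onE)
      fix u' u''
      assume "open V"
        "\<And>x. x \<in> V \<Longrightarrow> (u has_derivative blinfun_apply (u' x)) (at x)"
        "\<And>x. x \<in> V \<Longrightarrow> (u' has_derivative blinfun_apply (u'' x)) (at x)"
        "continuous_on V u''"
        "\<And>x. x \<in> V \<Longrightarrow> (\<Sum>b\<in>Basis. blinfun_apply (blinfun_apply (u'' x) b) b) = 0"
      with V(1,2) have "Q x V u' u''"
        unfolding Q_def by simp
      then show ?thesis by (intro exI)
    qed
  qed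
  from bchoice[OF this] obtain V where "\<forall>x\<in>U. \<exists>u' u''. Q x (V x) u' u''"
    by (elim exE)
  from bchoice[OF this] obtain d where "\<forall>x\<in>U. \<exists>u''. Q x (V x) (d x) u''"
    by (elim exE)
  from bchoice[OF this] obtain dd where "\<forall>x\<in>U. Q x (V x) (d x) (dd x)"
    by (elim exE)
  then have
    V: "\<And>x. x \<in> U \<Longrightarrow> x \<in> V x \<and> V x \<subseteq> U \<and> open (V x)"
    and d: "\<And>x y. x \<in> U \<Longrightarrow> y \<in> V x \<Longrightarrow> (u has_derivative blinfun_apply (d x y)) (at y)"
    and dd: "\<And>x y. x \<in> U \<Longrightarrow> y \<in> V x \<Longrightarrow> (d x has_derivative blinfun_apply (dd x y)) (at y)"
    and cont: "\<And>x. x \<in> U \<Longrightarrow> continuous_on (V x) (dd x)"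
    and lap: "\<And>x y. x \<in> U \<Longrightarrow> y \<in> V x \<Longrightarrow> (\<Sum>b\<in>Basis. blinfun_apply (blinfun_apply (dd x y) b) b) = 0"
    unfolding Q_def by simp_all
  define u' where "u' x = d x x" for x
  define u'' where "u'' x = dd x x" for x
  have "open U"
    using V by (meson open_subopen)
  have u': "u' y = d x y" if "x \<in> U" "y \<in> V x" for x y
  proof -
    have "y \<in> U" using that V by blast
    then have "(u has_derivative blinfun_apply (d y y)) (at y)"
      using d V by blast
    from has_derivative_unique[OF this d[OF that]] show ?thesis
      unfolding u'_def by (simp only: blinfun_apply_inject)
  qed
  have du': "(u' has_derivative blinfun_apply (dd x y)) (at y)" if "x \<in> U" "y \<in> V x" for x y
    using has_derivative_transform_within_open[OF dd[OF that], of "V x" u'] V[OF that(1)] u'[OF that(1)] that(2)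
    by simp
  have u'': "u'' y = dd x y" if "x \<in> U" "y \<in> V x" for x y
  proof -
    have "y \<in> U" using that V by blast
    then have "(u' has_derivative blinfun_apply (dd y y)) (at y)"
      using du' V by blast
    from has_derivative_unique[OF this du'[OF that]] show ?thesis
      unfolding u''_def by (simp only: blinfun_apply_inject)
  qed
  have "continuous_on U u''"
  proof -
    have "isCont u'' x" if "x \<in> U" for x
    proof -
      have "continuous_on (V x) u''"
        using cont[OF that] u''[OF that] by (simp cong: continuous_on_cong)
      then show ?thesis
        using V[OF that] continuous_on_eq_continuous_at by blast
    qed
    then show ?thesis
      by (simp add: continuous_at_imp_continuous_on)
  qed
  moreover have "(u has_derivative blinfun_apply (u' x)) (at x)" if "x \<in> U" for x
    using d[OF that] V[OF that] unfolding u'_def by blast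
  moreover have "(u' has_derivative blinfun_apply (u'' x)) (at x)" if "x \<in> U" for x
    using du'[OF that] V[OF that] unfolding u''_def by blast
  moreover have "(\<Sum>b\<in>Basis. blinfun_apply (blinfun_apply (u'' x) b) b) = 0" if "x \<in> U" for x
    using lap[OF that] V[OF that] unfolding u''_def by blast
  ultimately show ?thesis
    using \<open>open U\<close> by (intro harmonic_onI[of U u u' u''])
qed

lemma has_derivative_Basis_expansion:
  fixes u :: "'v::euclidean_space \<Rightarrow> 'b::real_normed_vector"
  assumes "(u has_derivative D) (at x)"
  shows "D v = (\<Sum>b\<in>Basis. (v \<bullet> b) *\<^sub>R D b)"
proof -
  have "linear D"
    using assms has_derivative_linear by blast
  then have "D (\<Sum>b\<in>Basis. (v \<bullet> b) *\<^sub>R b) = (\<Sum>b\<in>Basis. (v \<bullet> b) *\<^sub>R D b)"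
    by (simp add: linear_sum linear_cmul)
  then show ?thesis
    by (simp add: euclidean_representation)
qed

text \<open>The operator-valued derivatives are finite sums over \<open>Basis\<close> of scalar
  partial derivatives times fixed operators, and so inherit differentiability and continuity from
  the scalars.\<close>

lemma harmonic_onI_partial_derivatives:
  fixes u :: "'v::euclidean_space \<Rightarrow> real"
  assumes U: "open U"
    and p: "\<And>x. x \<in> U \<Longrightarrow> (u has_derivative (\<lambda>v. p v x)) (at x)"
    and q: "\<And>x b. x \<in> U \<Longrightarrow> b \<in> Basis \<Longrightarrow> (p b has_derivative (\<lambda>v. q v b x)) (at x)"
    and cont: "\<And>b c. b \<in> Basis \<Longrightarrow> c \<in> Basis \<Longrightarrow> continuous_on U (q c b)"
    and lap: "\<And>x. x \<in> U \<Longrightarrow> (\<Sum>b\<in>Basis. q b b x) = 0"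
  shows "harmonic_on u U"
proof -
  \<comment> \<open>\<open>T c b\<close> is the elementary bilinear form sending \<open>v\<close>
    and \<open>w\<close> to \<open>(v \<bullet> c) * (w \<bullet> b)\<close>.\<close>
  define T :: "'v \<Rightarrow> 'v \<Rightarrow> 'v \<Rightarrow>\<^sub>L 'v \<Rightarrow>\<^sub>L real"
    where "T c b = blinfun_scaleR_left (blinfun_inner_left b) o\<^sub>L blinfun_inner_left c" for c b
  have T: "blinfun_apply (T c b) v = (v \<bullet> c) *\<^sub>R blinfun_inner_left b" for c b v
    unfolding T_def by simp
  define u' where "u' x = (\<Sum>b\<in>Basis. p b x *\<^sub>R blinfun_inner_left b)" for x
  define u'' where "u'' x = (\<Sum>b\<in>Basis. \<Sum>c\<in>Basis. q c b x *\<^sub>R T c b)" for x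
  have u': "blinfun_apply (u' x) v = p v x" if "x \<in> U" for x v
    using has_derivative_Basis_expansion[OF p[OF that], of v]
    unfolding u'_def by (simp add: blinfun.sum_left blinfun.scaleR_left mult.commute)
  have u'': "blinfun_apply (u'' x) v = (\<Sum>b\<in>Basis. q v b x *\<^sub>R blinfun_inner_left b)" if "x \<in> U" for x v
  proof -
    have "(\<Sum>c\<in>Basis. (q c b x * (v \<bullet> c)) *\<^sub>R blinfun_inner_left b) = q v b x *\<^sub>R blinfun_inner_left b"
      if "b \<in> Basis" for b
      using has_derivative_Basis_expansion[OF q[OF \<open>x \<in> U\<close> that], of v]
      by (simp add: scaleR_sum_left mult.commute)
    then show ?thesis
      unfolding u''_def by (simp add: blinfun.sum_left blinfun.scaleR_left T)
  qed
  have "(u has_derivative blinfun_apply (u' x)) (at x)" if "x \<in> U" for x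
  proof -
    have "blinfun_apply (u' x) = (\<lambda>v. p v x)"
      by (rule ext) (rule u'[OF that])
    then show ?thesis
      using p[OF that] by simp
  qed
  moreover have "(u' has_derivative blinfun_apply (u'' x)) (at x)" if "x \<in> U" for x
  proof -
    have "(u' has_derivative (\<lambda>v. \<Sum>b\<in>Basis. q v b x *\<^sub>R blinfun_inner_left b)) (at x)"
      unfolding u'_def by (intro has_derivative_sum has_derivative_scaleR_left q that)
    then show ?thesis
      unfolding ext[OF u''[OF that], symmetric] .
  qed
  moreover have "continuous_on U u''"
    unfolding u''_def by (intro continuous_intros cont)
  moreover have "(\<Sum>e\<in>Basis. blinfun_apply (blinfun_apply (u'' x) e) e) = 0" if "x \<in> U" for x
  proof -
    have "blinfun_apply (blinfun_apply (u'' x) e) e = q e e x" if "e \<in> Basis" for e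
    proof -
      have "blinfun_apply (blinfun_apply (u'' x) e) e = (\<Sum>b\<in>Basis. q e b x * (e \<bullet> b))"
        by (simp add: u''[OF \<open>x \<in> U\<close>] blinfun.sum_left blinfun.scaleR_left)
      also have "\<dots> = (\<Sum>b\<in>Basis. if b = e then q e b x else 0)"
        using that by (intro sum.cong) (auto simp: inner_Basis)
      finally show ?thesis
        using that by simp
    qed
    then show ?thesis
      using lap[OF that] by simp
  qed
  ultimately show ?thesis
    using U by (intro harmonic_onI[of U u u' u''])
qed

lemma sum_Basis_complex_vec:
  fixes h :: "complex ^ 'n \<Rightarrow> real"
  shows "sum h Basis = (\<Sum>i\<in>UNIV. h (axis i 1) + h (axis i \<i>))"
proof -
  have Basis: "(Basis :: (complex ^ 'n) set) = (\<lambda>(i, u). axis i u) ` (UNIV \<times> {1, \<i>})"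
    unfolding Basis_vec_def Basis_complex_def by auto
  have inj: "inj_on (\<lambda>(i, u). axis i u :: complex ^ 'n) (UNIV \<times> {1, \<i>})"
    by (auto simp: inj_on_def axis_eq_axis)
  have "sum h Basis = (\<Sum>(i, u)\<in>UNIV \<times> {1, \<i>}. h (axis i u))"
    unfolding Basis sum.reindex[OF inj] by (simp add: o_def case_prod_unfold)
  also have "\<dots> = (\<Sum>i\<in>UNIV. \<Sum>u\<in>{1, \<i>}. h (axis i u))"
    by (rule sum.cartesian_product[symmetric])
  finally show ?thesis by simp
qed

text \<open>The second derivative is complex bilinear, so its value on \<open>\<i> *s v\<close>
  twice is minus its value on \<open>v\<close> twice. The real basis consists of pairs
  \<open>axis i 1\<close>, \<open>axis i \<i>\<close>, whose contributions to the Laplacian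
  cancel.\<close>

lemma harmonic_on_Re:
  fixes G :: "complex ^ 'n \<Rightarrow> complex"
  assumes G: "analytic_several_on G U"
  shows "harmonic_on (\<lambda>x. Re (G x)) U"
proof -
  have U: "open U" using G unfolding analytic_several_on_def by blast
  define D where "D v x = frechet_derivative G (at x) v" for v x
  define DD where "DD c v x = frechet_derivative (D v) (at x) c" for c v x
  have D: "analytic_several_on (D v) U" for v
    unfolding D_def by (rule analytic_several_frechet_derivative[OF G])
  have DD: "analytic_several_on (DD c v) U" for c v
    unfolding DD_def by (rule analytic_several_frechet_derivative[OF D])
  have dG: "(G has_derivative (\<lambda>v. D v x)) (at x)" if "x \<in> U" for x
    using analytic_several_has_derivative(1)[OF G that] unfolding D_def by simp
  have dD: "(D b has_derivative (\<lambda>v. DD v b x)) (at x)" if "x \<in> U" for b x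
    using analytic_several_has_derivative(1)[OF D that] unfolding DD_def by simp
  have DD_i: "DD (\<i> *s v) (\<i> *s v) x = - DD v v x" if x: "x \<in> U" for v x
  \<comment> \<open>Linearity in the outer direction is analyticity of \<open>D v\<close>; linearity
    in the inner one comes from differentiating the identity
    \<open>\<i> * D v y = D (\<i> *s v) y\<close> on the open set \<open>U\<close>.\<close>
  proof -
    have "((\<lambda>y. \<i> * D v y) has_derivative (\<lambda>h. \<i> * DD h v x)) (at x)"
      by (intro has_derivative_mult_right dD x)
    moreover have "\<i> * D v y = D (\<i> *s v) y" if "y \<in> U" for y
      using analytic_several_has_derivative(2)[OF G that] unfolding D_def by simp
    ultimately have "(D (\<i> *s v) has_derivative (\<lambda>h. \<i> * DD h v x)) (at x)"
      using has_derivative_transform_within_open[OF _ U x] by blast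
    from has_derivative_unique[OF this dD[OF x]]
    have "DD (\<i> *s v) (\<i> *s v) x = \<i> * DD (\<i> *s v) v x"
      by metis
    also have "DD (\<i> *s v) v x = \<i> * DD v v x"
      using analytic_several_has_derivative(2)[OF D x] unfolding DD_def by simp
    finally show ?thesis by simp
  qed
  show ?thesis
  proof (rule harmonic_onI_partial_derivatives[where p="\<lambda>v x. Re (D v x)" and q="\<lambda>c v x. Re (DD c v x)"])
    show "open U" by fact
    show "((\<lambda>x. Re (G x)) has_derivative (\<lambda>v. Re (D v x))) (at x)" if "x \<in> U" for x
      using bounded_linear.has_derivative[OF bounded_linear_Re dG[OF that]] .
    show "((\<lambda>x. Re (D b x)) has_derivative (\<lambda>v. Re (DD v b x))) (at x)" if "x \<in> U" for b x
      using bounded_linear.has_derivative[OF bounded_linear_Re dD[OF that]] .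
    show "continuous_on U (\<lambda>x. Re (DD c b x))" for b c
      by (intro continuous_intros analytic_several_continuous_on DD)
    show "(\<Sum>b\<in>Basis. Re (DD b b x)) = 0" if x: "x \<in> U" for x
    proof -
      have "axis i \<i> = \<i> *s (axis i 1 :: complex ^ 'n)" for i
        by (simp add: vec_eq_iff axis_def)
      then have "Re (DD (axis i 1) (axis i 1) x) + Re (DD (axis i \<i>) (axis i \<i>) x) = 0" for i
        by (simp add: DD_i[OF x])
      then show ?thesis
        by (simp add: sum_Basis_complex_vec)
    qed
  qed
qed

text \<open>
  All products \<open>a n * b m\<close> are bounded by 1 and close to 1 at \<open>w\<close>, so Harnack's inequality
  makes \<open>a\<close> uniformly Cauchy near \<open>w\<close>; its limit has modulus \<open>f / f w\<close>.
\<close>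

lemma ln_harmonic_near_if_peaking:
  fixes f :: "complex ^ 'n \<Rightarrow> real" and a b :: "nat \<Rightarrow> complex ^ 'n \<Rightarrow> complex"
  assumes r: "r > 0"
    and a: "\<And>n. analytic_several_on (a n) (ball w r)" and b: "\<And>n. analytic_several_on (b n) (ball w r)"
    and pos: "\<And>z. z \<in> ball w r \<Longrightarrow> f z > 0" and M: "\<And>z. z \<in> ball w r \<Longrightarrow> f z \<le> M"
    and a_le: "\<And>n z. z \<in> ball w r \<Longrightarrow> cmod (a n z) \<le> f z / f w"
    and b_le: "\<And>n z. z \<in> ball w r \<Longrightarrow> cmod (b n z) * f z \<le> f w"
    and lim: "(\<lambda>n. a n w) \<longlonglongrightarrow> 1" "(\<lambda>n. b n w) \<longlonglongrightarrow> 1"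
  shows "\<exists>s>0. s \<le> r \<and> harmonic_on (\<lambda>z. ln (f z)) (ball w s)"
proof -
  have w: "w \<in> ball w r" using r by simp
  have fw: "f w > 0" by (rule pos[OF w])
  define B where "B = M / f w"
  have "M > 0" using M[OF w] fw by linarith
  then have B: "B > 0" unfolding B_def using fw by simp
  have a_B: "cmod (a n z) \<le> B" if "z \<in> ball w r" for n z
    using a_le[OF that, of n] M[OF that] fw unfolding B_def
    by (meson divide_right_mono less_imp_le order_trans)
  have ab_le1: "cmod (a n z * b m z) \<le> 1" if z: "z \<in> ball w r" for n m z
  proof -
    have "cmod (a n z) * cmod (b m z) \<le> (f z / f w) * cmod (b m z)"
      by (intro mult_right_mono a_le z) auto
    also have "\<dots> = (cmod (b m z) * f z) / f w" by simp
    also have "\<dots> \<le> 1"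
      using b_le[OF z, of m] fw by simp
    finally show ?thesis by (simp add: norm_mult)
  qed
  have Harnack: "cmod (1 - a n z * b m z) \<le> 3 * cmod (1 - a n w * b m w)" if "z \<in> ball w (r / 2)" for n m z
    by (rule analytic_several_Harnack[OF analytic_several_mult[OF a b] ab_le1 that])
  have ab_w: "\<exists>N. \<forall>n\<ge>N. \<forall>m\<ge>N. cmod (1 - a n w * b m w) < e" if e: "e > 0" for e
  proof -
    have "((\<lambda>(n, m). a n w * b m w) \<longlongrightarrow> 1 * 1) (sequentially \<times>\<^sub>F sequentially)"
      unfolding case_prod_unfold
      by (intro tendsto_mult filterlim_compose[OF lim(1)] filterlim_compose[OF lim(2)] filterlim_fst filterlim_snd)
    from tendstoD[OF this e]
    have "\<forall>\<^sub>F x in sequentially \<times>\<^sub>F sequentially. cmod (1 - a (fst x) w * b (snd x) w) < e"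
      by (simp add: case_prod_unfold dist_norm norm_minus_commute)
    then show ?thesis
      unfolding eventually_prod_sequentially by auto
  qed
  have half: "z \<in> ball w r" if "z \<in> ball w (r / 2)" for z
    using that r by simp
  have "uniformly_Cauchy_on (ball w (r / 2)) a"
  proof (rule uniformly_Cauchy_onI)
    fix e :: real assume e: "e > 0"
    \<comment> \<open>\<open>3 * \<delta> \<le> 1 / 2\<close> keeps \<open>a n z * b n z\<close>
      away from 0, giving \<open>cmod (b n z) \<ge> 1 / (2 * B)\<close>. Two Harnack errors of
      \<open>3 * \<delta>\<close> divided by this bound give
      \<open>12 * \<delta> * B\<close>.\<close>
    define \<delta> where "\<delta> = min (1 / 6) (e / (24 * B))"
    have \<delta>: "\<delta> > 0" "3 * \<delta> \<le> 1 / 2" "12 * \<delta> * B < e"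
    proof -
      show "\<delta> > 0" "3 * \<delta> \<le> 1 / 2"
        using e B unfolding \<delta>_def by auto
      have "\<delta> * B \<le> e / (24 * B) * B"
        using B unfolding \<delta>_def by (intro mult_right_mono) auto
      then show "12 * \<delta> * B < e"
        using B e by simp
    qed
    obtain N where N: "\<And>n m. n \<ge> N \<Longrightarrow> m \<ge> N \<Longrightarrow> cmod (1 - a n w * b m w) < \<delta>"
      using ab_w[OF \<delta>(1)] by blast
    have "dist (a m z) (a n z) < e" if z: "z \<in> ball w (r / 2)" and mn: "m \<ge> N" "n \<ge> N" for z m n
    proof -
      have close: "cmod (1 - a k z * b n z) \<le> 3 * \<delta>" if "k \<ge> N" for k
        using Harnack[OF z, of k n] N[OF that mn(2)] by linarith
      have "1 / 2 \<le> cmod (a n z * b n z)"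
        using close[OF mn(2)] \<delta>(2) norm_triangle_ineq2[of 1 "a n z * b n z"]
        norm_triangle_ineq2[of 1 "1 - a n z * b n z"] by simp
      also have "\<dots> \<le> B * cmod (b n z)"
        unfolding norm_mult by (intro mult_right_mono a_B half z) auto
      finally have b_low: "1 / 2 \<le> B * cmod (b n z)" .
      have "cmod (a m z - a n z) * cmod (b n z) = cmod ((1 - a n z * b n z) - (1 - a m z * b n z))"
        unfolding norm_mult[symmetric] by (simp add: algebra_simps)
      also have "\<dots> \<le> 6 * \<delta>"
        using norm_triangle_ineq4[of "1 - a n z * b n z" "1 - a m z * b n z"] close[OF mn(1)] close[OF mn(2)] by simp
      finally have *: "cmod (a m z - a n z) * cmod (b n z) \<le> 6 * \<delta>" .
      have "cmod (a m z - a n z) * (1 / 2) \<le> cmod (a m z - a n z) * (B * cmod (b n z))"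
        by (intro mult_left_mono b_low) auto
      also have "\<dots> = B * (cmod (a m z - a n z) * cmod (b n z))" by simp
      also have "\<dots> \<le> B * (6 * \<delta>)"
        using * B by (intro mult_left_mono) auto
      finally show ?thesis
        using \<delta>(3) by (simp add: dist_norm mult_ac)
    qed
    then show "\<exists>M. \<forall>z\<in>ball w (r / 2). \<forall>m\<ge>M. \<forall>n\<ge>M. dist (a m z) (a n z) < e"
      by blast
  qed
  then obtain F where F: "uniform_limit (ball w (r / 2)) a F sequentially"
    using Cauchy_uniformly_convergent unfolding uniformly_convergent_on_def by blast
  have F_analytic: "analytic_several_on F (ball w (r / 2))"
    by (rule analytic_several_uniform_limit[OF _ F])
       (use r in \<open>auto intro!: analytic_several_subset[OF a]\<close>)
  have a_lim: "(\<lambda>n. a n z) \<longlonglongrightarrow> F z" if "z \<in> ball w (r / 2)" for z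
    using tendsto_uniform_limitI[OF F that] .
  have norm_F: "f z = f w * cmod (F z)" if z: "z \<in> ball w (r / 2)" for z
  proof -
    have fz: "f z > 0" by (rule pos[OF half[OF z]])
    have "cmod (F z) \<le> f z / f w"
      by (rule LIMSEQ_le_const2[OF tendsto_norm[OF a_lim[OF z]]]) (use a_le[OF half[OF z]] in blast)
    \<comment> \<open>The bound on \<open>b n\<close> turns \<open>a n z * b n z\<close> into a
      lower bound for \<open>a n z\<close>; by Harnack that product tends to 1 at \<open>z\<close>
      as well.\<close>
    moreover have "f z / f w \<le> cmod (F z)"
    proof -
      have "(\<lambda>n. 3 * cmod (1 - a n w * b n w)) \<longlonglongrightarrow> 3 * cmod (1 - 1 * 1)"
        by (intro tendsto_intros lim)
      then have "(\<lambda>n. 3 * cmod (1 - a n w * b n w)) \<longlonglongrightarrow> 0" by simp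
      then have "(\<lambda>n. 1 - a n z * b n z) \<longlonglongrightarrow> 0"
        by (rule Lim_null_comparison[rotated]) (use Harnack[OF z] in auto)
      then have "(\<lambda>n. 1 - (1 - a n z * b n z)) \<longlonglongrightarrow> 1 - 0"
        by (intro tendsto_diff tendsto_const)
      then have "(\<lambda>n. cmod (a n z * b n z) * (f z / f w)) \<longlonglongrightarrow> cmod 1 * (f z / f w)"
        by (intro tendsto_mult tendsto_norm tendsto_const) simp
      moreover have "cmod (a n z * b n z) * (f z / f w) \<le> cmod (a n z)" for n
      proof -
        have "cmod (b n z) * f z / f w \<le> 1"
          using b_le[OF half[OF z], of n] fw by simp
        from mult_left_mono[OF this, of "cmod (a n z)"] show ?thesis
          by (simp add: norm_mult)
      qed
      ultimately show ?thesis
        using LIMSEQ_le[OF _ tendsto_norm[OF a_lim[OF z]]] by fastforce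
    qed
    ultimately show ?thesis
      using fw by (simp add: field_simps)
  qed
  have w2: "w \<in> ball w (r / 2)" using r by simp
  have "F w = 1"
    using LIMSEQ_unique[OF a_lim[OF w2] lim(1)] .
  moreover have "isCont F w"
    using analytic_several_continuous_on[OF F_analytic] w2 continuous_on_eq_continuous_at[OF open_ball] by blast
  ultimately obtain d where d: "d > 0" "\<And>z. dist z w < d \<Longrightarrow> dist (F z) 1 < 1"
    unfolding continuous_at_eps_delta by (metis zero_less_one)
  \<comment> \<open>Since \<open>F w = 1\<close>, shrinking the ball keeps \<open>F\<close> in
    \<open>ball 1 1\<close>, inside the right half-plane, where \<open>Ln\<close> is holomorphic.
    Adding \<open>ln (f w)\<close> makes the real part equal to \<open>ln (f z)\<close>.\<close>
  define s where "s = min d (r / 2)"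
  have s: "s > 0" "s \<le> r / 2" using d r unfolding s_def by auto
  have F1: "F z \<in> ball 1 1" if "z \<in> ball w s" for z
    using d(2)[of z] that unfolding s_def by (simp add: dist_commute)
  have Re_pos: "Re x > 0" if "x \<in> ball 1 1" for x
    using that complex_Re_le_cmod[of "1 - x"] by (simp add: dist_norm)
  have "(\<lambda>x. Ln x + of_real (ln (f w))) holomorphic_on ball 1 1"
    using Re_pos by (intro holomorphic_intros) (force elim!: nonpos_Reals_cases)
  then have "analytic_several_on (\<lambda>z. Ln (F z) + of_real (ln (f w))) (ball w s)"
    using F1 s(2) by (intro analytic_several_compose[OF analytic_several_subset[OF F_analytic]]) auto
  from harmonic_on_Re[OF this] have "harmonic_on (\<lambda>z. ln (f z)) (ball w s)"
  proof (rule harmonic_on_cong)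
    fix z assume z: "z \<in> ball w s"
    have "F z \<noteq> 0"
      using Re_pos[OF F1[OF z]] by auto
    then show "Re (Ln (F z) + of_real (ln (f w))) = ln (f z)"
      using norm_F[of z] z s(2) fw by (auto simp: ln_mult)
  qed
  then show ?thesis
    using s r by (intro exI[of _ s]) auto
qed

section \<open>Analytic pieces of the space, and the conclusion\<close>

lemma R_class_ln_harmonic:
  fixes R :: "(complex ^ 'n) set" and \<iota> :: "complex ^ 'n \<Rightarrow> 'a"
  assumes comp: "compact_space X" and A: "uniform_algebra X A" and f: "f \<in> R_class X A E"
    and R: "open R" "\<iota> ` R \<subseteq> topspace X"
    and analytic: "\<And>a. a \<in> A \<Longrightarrow> analytic_several_on (\<lambda>z. a (\<iota> z)) R"
  shows "harmonic_on (\<lambda>z. ln (f (\<iota> z))) {z \<in> R. \<iota> z \<notin> E}"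
proof (rule harmonic_on_local)
  fix w assume "w \<in> {z \<in> R. \<iota> z \<notin> E}"
  then have w: "w \<in> R" "\<iota> w \<in> topspace X" "\<iota> w \<notin> E"
    using R(2) by auto
  have fw: "f (\<iota> w) > 0"
    using R_class_pos[OF f w(2,3)] .
  obtain a b where a: "\<forall>n. a n \<in> A" and b: "\<forall>n. b n \<in> A"
      and a_le: "\<forall>n. \<forall>w'\<in>topspace X. cmod (a n w') \<le> f w' / f (\<iota> w)"
      and b_le: "\<forall>n. \<forall>w'\<in>topspace X. cmod (b n w') * f w' \<le> f (\<iota> w)"
      and lim: "(\<lambda>n. a n (\<iota> w)) \<longlonglongrightarrow> 1" "(\<lambda>n. b n (\<iota> w)) \<longlonglongrightarrow> 1"
    using R_class_peaking[OF A f w(2,3)] by (elim exE conjE)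
  obtain x where "x \<in> topspace X" and x: "\<And>y. y \<in> topspace X \<Longrightarrow> f y \<le> f x"
    using compactin_attains_sup[OF _ _ R_class_continuous[OF f], of "topspace X"] comp w(2)
    unfolding compact_space_def by blast
  \<comment> \<open>Information about \<open>\<iota>\<close> comes only through the functions of
    \<open>A\<close>. Positivity of \<open>f\<close> near \<open>w\<close> is therefore read off
    \<open>a N\<close>: it is analytic along \<open>\<iota>\<close>, nonzero near \<open>w\<close>,
    and bounded by \<open>f / f (\<iota> w)\<close>.\<close>
  obtain N where N: "a N (\<iota> w) \<noteq> 0"
    using tendsto_imp_eventually_ne[OF lim(1) one_neq_zero] unfolding eventually_sequentially by blast
  have "open {z \<in> R. a N (\<iota> z) \<in> - {0}}"
    using continuous_open_preimage[OF analytic_several_continuous_on[OF analytic] R(1), of "a N" "- {0}"] a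
    by (auto simp: vimage_def Int_def)
  then obtain r where r: "r > 0" "ball w r \<subseteq> {z \<in> R. a N (\<iota> z) \<in> - {0}}"
    using N w(1) unfolding open_contains_ball by auto
  have ball: "z \<in> R" "\<iota> z \<in> topspace X" "f (\<iota> z) > 0" if "z \<in> ball w r" for z
  proof -
    show "z \<in> R"
      using that r(2) by auto
    then show z: "\<iota> z \<in> topspace X"
      using R(2) by blast
    have "0 < cmod (a N (\<iota> z))"
      using that r(2) by auto
    also have "\<dots> \<le> f (\<iota> z) / f (\<iota> w)"
      using a_le z by blast
    finally show "f (\<iota> z) > 0"
      using fw by (simp add: zero_less_divide_iff)
  qed
  have "\<exists>s>0. s \<le> r \<and> harmonic_on (\<lambda>z. ln (f (\<iota> z))) (ball w s)"
  proof (rule ln_harmonic_near_if_peaking[where a="\<lambda>n z. a n (\<iota> z)" and b="\<lambda>n z. b n (\<iota> z)" and M="f x"])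
    show "analytic_several_on (\<lambda>z. a n (\<iota> z)) (ball w r)" for n
      using analytic_several_subset[OF analytic open_ball] a ball(1) by blast
    show "analytic_several_on (\<lambda>z. b n (\<iota> z)) (ball w r)" for n
      using analytic_several_subset[OF analytic open_ball] b ball(1) by blast
  qed (use r ball x a_le b_le lim in auto)
  then obtain s where "s > 0" "s \<le> r" "harmonic_on (\<lambda>z. ln (f (\<iota> z))) (ball w s)"
    by blast
  moreover have "ball w s \<subseteq> {z \<in> R. \<iota> z \<notin> E}"
  proof
    fix z assume "z \<in> ball w s"
    then have "z \<in> ball w r" using \<open>s \<le> r\<close> by simp
    then show "z \<in> {z \<in> R. \<iota> z \<notin> E}"
      using ball[of z] R_class_zero_iff[OF f, of "\<iota> z"] by auto
  qed
  ultimately show "\<exists>V. w \<in> V \<and> V \<subseteq> {z \<in> R. \<iota> z \<notin> E} \<and> harmonic_on (\<lambda>z. ln (f (\<iota> z))) V"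
    by (intro exI[of _ "ball w s"]) simp
qed

theorem proposition8p11:
  fixes X :: "'a topology" and A :: "('a \<Rightarrow> complex) set"
    and E :: "'a set" and f :: "'a \<Rightarrow> real"
  assumes "compact_space X" and "Hausdorff_space X" and "topspace X \<noteq> {}"
    and "uniform_algebra X A"
    and "closedin X E"
    and "f \<in> R_class X A E"
  shows
    "restrict f (shilov_boundary X A)
       \<in> R_class (subtopology X (shilov_boundary X A))
            (restrict_algebra A (shilov_boundary X A)) (E \<inter> shilov_boundary X A)
     \<and> ((\<exists>x\<in>shilov_boundary X A. \<forall>w\<in>topspace X. log_ereal (f w) \<le> log_ereal (f x)) \<and>
        (\<exists>x\<in>shilov_boundary X A. \<forall>w\<in>topspace X. log_ereal (f x) \<le> log_ereal (f w)))
     \<and> (\<forall>(R :: (complex ^ 'n) set) (\<iota> :: complex ^ 'n \<Rightarrow> 'a).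
          open R \<and> connected R \<and> R \<noteq> {} \<and> inj_on \<iota> R \<and> \<iota> ` R \<subseteq> topspace X \<and>
          (\<forall>a\<in>A. analytic_several_on (\<lambda>z. a (\<iota> z)) R) \<longrightarrow>
          {z \<in> R. \<bar>log_ereal (f (\<iota> z))\<bar> \<noteq> \<infinity>} = {z \<in> R. \<iota> z \<notin> E} \<and>
          harmonic_on (\<lambda>z. real_of_ereal (log_ereal (f (\<iota> z)))) {z \<in> R. \<iota> z \<notin> E})"
proof -
  let ?S = "shilov_boundary X A"
  have S: "closed_boundary X A ?S"
    using closed_boundary_shilov_boundary[OF assms(4,1,3)] .
  then have SX: "?S \<subseteq> topspace X"
    using closedin_subset unfolding closed_boundary_def by blast
  note f = assms(6)
  have "\<exists>x\<in>?S. \<forall>w\<in>topspace X. log_ereal (f w) \<le> log_ereal (f x)"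
    using R_class_max_on_closed_boundary[OF assms(1,4) S f] log_ereal_mono[OF R_class_nonneg[OF f]]
    by meson
  moreover have "\<exists>x\<in>?S. \<forall>w\<in>topspace X. log_ereal (f x) \<le> log_ereal (f w)"
    using R_class_min_on_closed_boundary[OF assms(1,4) S f] log_ereal_mono[OF R_class_nonneg[OF f]] SX
    by (meson subsetD)
  moreover have "{z \<in> R. \<bar>log_ereal (f (\<iota> z))\<bar> \<noteq> \<infinity>} = {z \<in> R. \<iota> z \<notin> E} \<and>
      harmonic_on (\<lambda>z. real_of_ereal (log_ereal (f (\<iota> z)))) {z \<in> R. \<iota> z \<notin> E}"
    if R: "open R \<and> connected R \<and> R \<noteq> {} \<and> inj_on \<iota> R \<and> \<iota> ` R \<subseteq> topspace X \<and>
      (\<forall>a\<in>A. analytic_several_on (\<lambda>z. a (\<iota> z)) R)" for R :: "(complex ^ 'n) set" and \<iota>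
  proof
    have zero: "f (\<iota> z) = 0 \<longleftrightarrow> \<iota> z \<in> E" if "z \<in> R" for z
      using R_class_zero_iff[OF f] R that by blast
    then show "{z \<in> R. \<bar>log_ereal (f (\<iota> z))\<bar> \<noteq> \<infinity>} = {z \<in> R. \<iota> z \<notin> E}"
      unfolding log_ereal_def by auto
    have "harmonic_on (\<lambda>z. ln (f (\<iota> z))) {z \<in> R. \<iota> z \<notin> E}"
      using R by (intro R_class_ln_harmonic[OF assms(1,4) f]) auto
    then show "harmonic_on (\<lambda>z. real_of_ereal (log_ereal (f (\<iota> z)))) {z \<in> R. \<iota> z \<notin> E}"
      by (rule harmonic_on_cong) (auto simp: log_ereal_def zero)
  qed
  ultimately show ?thesis
    using R_class_restrict[OF f SX] by blast
qed

end
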